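(* Let $B\subset B(H)$ be a finite dimensional $C^*$-algebra equipped with a faithful positive functional $\psi$ such that $mm^*=\mathrm{Id}$. Then the map $P\mapsto V_P$ is a one-to-one correspondence between projections $P\in B\otimes B^{\mathrm{op}}$ and weak$^*$ closed $B'$-bimodules $V\subset B(H)$. Moreover, if $V=V_P$, then the bimodule $V^*=\{T^*:T\in V\}$ corresponds to the tensor flip of $P$, i.e. $V_{\Sigma(P)}=(V_P)^*$.
   Context: $H$ is a Hilbert space (possibly infinite dimensional), the inclusion $B\subset B(H)$ is a unital faithful representation, and $B'$ is the commutant. Write $B=\bigoplus_\alpha M_{n_\alpha}$ (finite direct sum) and $\psi(x)=\sum_\alpha \mathrm{Tr}(\rho_\alpha^{-1})\,\mathrm{Tr}(\rho_\alpha x_\alpha)$ with $\rho_\alpha\in M_{n_\alpha}$ positive definite; faithful positive functionals with $mm^*=\mathrm{Id}$ are exactly those of this form ($m:B\otimes B\to B$ is the multiplication, $m^*$ its adjoint for the inner products induced by $\psi$). Let $\rho=(\rho_\alpha)_\alpha\in B\subset B(H)$. $B^{\mathrm{op}}$ is $B$ with multiplication $x^{\mathrm{op}}y^{\mathrm{op}}=(yx)^{\mathrm{op}}$; projections are self-adjoint idempotents; the tensor flip is $\Sigma(a\otimes b^{\mathrm{op}})=b\otimes a^{\mathrm{op}}$. For $z\in\mathbb C$ and $x\in B(H)$ let $\sigma_z^{\psi^{-1}}(x)=\rho^{-iz}x\rho^{iz}$ (the modular group attached to the operator valued weight $\psi^{-1}:B(H)\to B'$ induced by $\psi$, evaluated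 using the density $\rho^{-1}$), so that $\sigma^{\psi^{-1}}_{-i/2}(c)=\rho^{-1/2}c\rho^{1/2}$ and $\sigma^{\psi^{-1}}_{i/4}(x)=\rho^{1/4}x\rho^{-1/4}$. For $P\in B\otimes B^{\mathrm{op}}$ let $\Phi(P):B(H)\to B(H)$ be the $B'$-bimodular map obtained by linear extension of $\Phi(b\otimes c^{\mathrm{op}})(x)=b\,x\,\sigma^{\psi^{-1}}_{-i/2}(c)$. For a projection $P$ put $V_P:=\sigma^{\psi^{-1}}_{i/4}\big(\mathrm{Im}\,\Phi(P)\big)$. *)

theory Defs
  imports "HOL-Analysis.Analysis"
begin

section \<open>Complex Hilbert spaces and their bounded operators\<close>

text \<open>Inner products are linear in the second argument. The norm is tied to the inner product,
  so positivity and definiteness come from the norm, and completeness from \<^class>\<open>banach\<close>.\<close>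

class complex_hilbert_space = banach +
  fixes scaleC :: "complex \<Rightarrow> 'a \<Rightarrow> 'a" (infixr "*\<^sub>C" 75)
    and cinner :: "'a \<Rightarrow> 'a \<Rightarrow> complex"
  assumes scaleC_add_right: "c *\<^sub>C (x + y) = c *\<^sub>C x + c *\<^sub>C y"
    and scaleC_add_left: "(c + d) *\<^sub>C x = c *\<^sub>C x + d *\<^sub>C x"
    and scaleC_scaleC: "c *\<^sub>C (d *\<^sub>C x) = (c * d) *\<^sub>C x"
    and scaleR_scaleC: "r *\<^sub>R x = complex_of_real r *\<^sub>C x"
    and cinner_commute: "cinner x y = cnj (cinner y x)"
    and cinner_add_right: "cinner x (y + z) = cinner x y + cinner x z"
    and cinner_scaleC_right: "cinner x (c *\<^sub>C y) = c * cinner x y"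
    and cinner_norm: "cinner x x = complex_of_real ((norm x)\<^sup>2)"

definition bounded_ops :: "('h::complex_hilbert_space \<Rightarrow> 'h) set" where
  "bounded_ops = {T. bounded_linear T \<and> (\<forall>c x. T (c *\<^sub>C x) = c *\<^sub>C T x)}"

definition op_adj :: "('h::complex_hilbert_space \<Rightarrow> 'h) \<Rightarrow> ('h \<Rightarrow> 'h)" where
  "op_adj T = (THE S. S \<in> bounded_ops \<and> (\<forall>x y. cinner (S x) y = cinner x (T y)))"

definition commutant :: "('h::complex_hilbert_space \<Rightarrow> 'h) set \<Rightarrow> ('h \<Rightarrow> 'h) set" where
  "commutant A = {T \<in> bounded_ops. \<forall>S\<in>A. T \<circ> S = S \<circ> T}"

definition op_subspace :: "('h::complex_hilbert_space \<Rightarrow> 'h) set \<Rightarrow> bool" where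
  "op_subspace V \<longleftrightarrow> V \<subseteq> bounded_ops \<and> (\<lambda>v. 0) \<in> V \<and>
     (\<forall>S\<in>V. \<forall>T\<in>V. (\<lambda>v. S v + T v) \<in> V) \<and> (\<forall>c. \<forall>T\<in>V. (\<lambda>v. c *\<^sub>C T v) \<in> V)"

definition op_bimodule ::
  "('h::complex_hilbert_space \<Rightarrow> 'h) set \<Rightarrow> ('h \<Rightarrow> 'h) set \<Rightarrow> bool" where
  "op_bimodule A V \<longleftrightarrow> op_subspace V \<and> (\<forall>a\<in>A. \<forall>b\<in>A. \<forall>T\<in>V. a \<circ> T \<circ> b \<in> V)"

text \<open>The weak* topology of \<open>B(H)\<close> as the dual of the trace class operators, that is the
  ultraweak topology. The functionals given by the predual are exactly
  \<open>T \<mapsto> \<Sum>\<^sub>n \<langle>\<xi>\<^sub>n, T \<eta>\<^sub>n\<rangle>\<close> with square-summable sequences \<open>\<xi>\<close>, \<open>\<eta>\<close>; sequences suffice also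
  for nonseparable \<open>H\<close>.\<close>

definition normal_functionals :: "(('h::complex_hilbert_space \<Rightarrow> 'h) \<Rightarrow> complex) set" where
  "normal_functionals =
     {\<lambda>T. (\<Sum>n. cinner (\<xi> n) (T (\<eta> n))) | (\<xi> :: nat \<Rightarrow> 'h) (\<eta> :: nat \<Rightarrow> 'h).
        summable (\<lambda>n. (norm (\<xi> n))\<^sup>2) \<and> summable (\<lambda>n. (norm (\<eta> n))\<^sup>2)}"

definition weak_star_topology :: "('h::complex_hilbert_space \<Rightarrow> 'h) topology" where
  "weak_star_topology =
     topology_generated_by {{T \<in> bounded_ops. \<omega> T \<in> U} | \<omega> U. \<omega> \<in> normal_functionals \<and> open U}"

section \<open>Finite direct sums of full matrix algebras\<close>

text \<open>The direct sum of the \<open>M\<^bsub>n\<^sub>\<alpha>\<^esub>\<close> is realised as the algebra of block diagonal matrices: the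
  rows carry block labels \<open>blk\<close>, the labels in use are \<open>range blk\<close>, and \<open>n\<^sub>\<alpha>\<close> is the number of
  rows with label \<open>\<alpha>\<close>. Multiplication, unit and inverse are those of matrices.\<close>

definition block_algebra :: "('i::finite \<Rightarrow> 'a) \<Rightarrow> (complex^'i^'i) set" where
  "block_algebra blk = {x. \<forall>i j. blk i \<noteq> blk j \<longrightarrow> x $ i $ j = 0}"

definition mat_adj :: "complex^'i^'i \<Rightarrow> complex^'i^'i" where
  "mat_adj x = (\<chi> i j. cnj (x $ j $ i))"

definition mat_scale :: "complex \<Rightarrow> complex^'i^'i \<Rightarrow> complex^'i^'i" where
  "mat_scale c x = (\<chi> i j. c * x $ i $ j)"

definition matrix_unit :: "'i \<Rightarrow> 'i \<Rightarrow> complex^'i^'i" where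
  "matrix_unit i j = (\<chi> p q. if p = i \<and> q = j then 1 else 0)"

definition block_trace :: "('i::finite \<Rightarrow> 'a) \<Rightarrow> 'a \<Rightarrow> complex^'i^'i \<Rightarrow> complex" where
  "block_trace blk \<alpha> x = (\<Sum>i | blk i = \<alpha>. x $ i $ i)"

definition pos_def :: "complex^'i::finite^'i \<Rightarrow> bool" where
  "pos_def r \<longleftrightarrow> mat_adj r = r \<and>
     (\<forall>v. v \<noteq> 0 \<longrightarrow> Re (\<Sum>i\<in>UNIV. cnj (v $ i) * (r *v v) $ i) > 0)"

text \<open>Functional calculus: the power \<open>r\<^sup>z\<close> of a positive definite matrix acts on the
  \<open>\<lambda>\<close>-eigenspace of \<open>r\<close> as \<open>\<lambda>\<^sup>z\<close>. As \<open>r\<close> is diagonalisable, this determines it.\<close>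

definition mat_powr :: "complex^'i::finite^'i \<Rightarrow> complex \<Rightarrow> complex^'i^'i" where
  "mat_powr r z = (THE x. \<forall>l::real. \<forall>v.
     r *v v = complex_of_real l *s v \<longrightarrow> x *v v = (complex_of_real l powr z) *s v)"

definition unital_faithful_rep ::
  "('i::finite \<Rightarrow> 'a) \<Rightarrow> (complex^'i^'i \<Rightarrow> ('h::complex_hilbert_space \<Rightarrow> 'h)) \<Rightarrow> bool" where
  "unital_faithful_rep blk \<pi> \<longleftrightarrow>
     \<pi> ` block_algebra blk \<subseteq> bounded_ops \<and>
     (\<forall>x\<in>block_algebra blk. \<forall>y\<in>block_algebra blk. \<pi> (x + y) = (\<lambda>v. \<pi> x v + \<pi> y v)) \<and>
     (\<forall>c. \<forall>x\<in>block_algebra blk. \<pi> (mat_scale c x) = (\<lambda>v. c *\<^sub>C \<pi> x v)) \<and>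
     (\<forall>x\<in>block_algebra blk. \<forall>y\<in>block_algebra blk. \<pi> (x ** y) = \<pi> x \<circ> \<pi> y) \<and>
     (\<forall>x\<in>block_algebra blk. \<pi> (mat_adj x) = op_adj (\<pi> x)) \<and>
     \<pi> (mat 1) = id \<and>
     inj_on \<pi> (block_algebra blk)"

definition faithful_positive_functional ::
  "('i::finite \<Rightarrow> 'a) \<Rightarrow> (complex^'i^'i \<Rightarrow> complex) \<Rightarrow> bool" where
  "faithful_positive_functional blk \<psi> \<longleftrightarrow>
     (\<forall>x\<in>block_algebra blk. \<forall>y\<in>block_algebra blk. \<psi> (x + y) = \<psi> x + \<psi> y) \<and>
     (\<forall>c. \<forall>x\<in>block_algebra blk. \<psi> (mat_scale c x) = c * \<psi> x) \<and>
     (\<forall>x\<in>block_algebra blk. \<psi> (mat_adj x ** x) \<in> \<real>\<^sub>\<ge>\<^sub>0) \<and>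
     (\<forall>x\<in>block_algebra blk. \<psi> (mat_adj x ** x) = 0 \<longrightarrow> x = 0)"

section \<open>Tensor products of the block algebra\<close>

text \<open>A tensor \<open>t\<close> stands for \<open>\<Sum> t i j k l \<cdot> e\<^sub>i\<^sub>j \<otimes> e\<^sub>k\<^sub>l\<close> with matrix units \<open>e\<^sub>i\<^sub>j\<close>. The underlying
  vector space of \<open>B \<otimes> B\<close> and of \<open>B \<otimes> B\<^sup>o\<^sup>p\<close> is the same; they differ in the multiplication
  (\<open>tensor_mult\<close> and \<open>op_mult\<close>).\<close>

type_synonym 'i tensor = "'i \<Rightarrow> 'i \<Rightarrow> 'i \<Rightarrow> 'i \<Rightarrow> complex"

definition tensor_space :: "('i::finite \<Rightarrow> 'a) \<Rightarrow> 'i tensor set" where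
  "tensor_space blk = {t. \<forall>i j k l. blk i \<noteq> blk j \<or> blk k \<noteq> blk l \<longrightarrow> t i j k l = 0}"

definition elem_tensor :: "complex^'i^'i \<Rightarrow> complex^'i^'i \<Rightarrow> 'i tensor" where
  "elem_tensor b c = (\<lambda>i j k l. b $ i $ j * c $ k $ l)"

definition tensor_mult :: "'i::finite tensor \<Rightarrow> 'i tensor \<Rightarrow> 'i tensor" where
  "tensor_mult s t = (\<lambda>i j k l. \<Sum>p\<in>UNIV. \<Sum>q\<in>UNIV. s i p k q * t p j q l)"

definition op_mult :: "'i::finite tensor \<Rightarrow> 'i tensor \<Rightarrow> 'i tensor" where
  "op_mult s t = (\<lambda>i j k l. \<Sum>p\<in>UNIV. \<Sum>q\<in>UNIV. s i p q l * t p j k q)"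

definition tensor_adj :: "'i tensor \<Rightarrow> 'i tensor" where
  "tensor_adj t = (\<lambda>i j k l. cnj (t j i l k))"

definition tensor_flip :: "'i tensor \<Rightarrow> 'i tensor" where
  "tensor_flip t = (\<lambda>i j k l. t k l i j)"

text \<open>The multiplication map \<open>m : B \<otimes> B \<rightarrow> B\<close>.\<close>

definition mult_map :: "'i::finite tensor \<Rightarrow> complex^'i^'i" where
  "mult_map t = (\<chi> i l. \<Sum>p\<in>UNIV. t i p p l)"

lemma tensor_mult_elem:
  "tensor_mult (elem_tensor b c) (elem_tensor b' c') = elem_tensor (b ** b') (c ** c')"
  by (auto simp: tensor_mult_def elem_tensor_def matrix_matrix_mult_def sum_product
      intro!: ext sum.cong)

lemma op_mult_elem:
  "op_mult (elem_tensor b c) (elem_tensor b' c') = elem_tensor (b ** b') (c' ** c)"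
  by (auto simp: op_mult_def elem_tensor_def matrix_matrix_mult_def sum_product
      intro!: ext sum.cong)

lemma tensor_adj_elem: "tensor_adj (elem_tensor b c) = elem_tensor (mat_adj b) (mat_adj c)"
  by (simp add: tensor_adj_def elem_tensor_def mat_adj_def)

lemma tensor_flip_elem: "tensor_flip (elem_tensor a b) = elem_tensor b a"
  by (simp add: tensor_flip_def elem_tensor_def mult.commute)

lemma mult_map_elem: "mult_map (elem_tensor b c) = b ** c"
  by (simp add: mult_map_def elem_tensor_def matrix_matrix_mult_def)

lemma elem_tensor_in_space:
  "b \<in> block_algebra blk \<Longrightarrow> c \<in> block_algebra blk \<Longrightarrow> elem_tensor b c \<in> tensor_space blk"
  by (auto simp: block_algebra_def tensor_space_def elem_tensor_def)

text \<open>The inner products \<open>\<langle>x, y\<rangle> = \<psi>(x\<^sup>* y)\<close> on \<open>B\<close> and \<open>\<langle>s, t\<rangle> = (\<psi> \<otimes> \<psi>)(s\<^sup>* t)\<close> on \<open>B \<otimes> B\<close>. On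
  \<open>tensor_space\<close> the terms with \<open>matrix_unit\<close> outside the block algebra have coefficient 0.\<close>

definition psi_inner :: "(complex^'i::finite^'i \<Rightarrow> complex) \<Rightarrow> complex^'i^'i \<Rightarrow> complex^'i^'i \<Rightarrow> complex" where
  "psi_inner \<psi> x y = \<psi> (mat_adj x ** y)"

definition tensor_functional :: "(complex^'i::finite^'i \<Rightarrow> complex) \<Rightarrow> 'i tensor \<Rightarrow> complex" where
  "tensor_functional \<psi> t = (\<Sum>i\<in>UNIV. \<Sum>j\<in>UNIV. \<Sum>k\<in>UNIV. \<Sum>l\<in>UNIV.
     t i j k l * \<psi> (matrix_unit i j) * \<psi> (matrix_unit k l))"

definition tensor_inner :: "(complex^'i::finite^'i \<Rightarrow> complex) \<Rightarrow> 'i tensor \<Rightarrow> 'i tensor \<Rightarrow> complex" where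
  "tensor_inner \<psi> s t = tensor_functional \<psi> (tensor_mult (tensor_adj s) t)"

definition mult_map_adj ::
  "('i::finite \<Rightarrow> 'a) \<Rightarrow> (complex^'i^'i \<Rightarrow> complex) \<Rightarrow> complex^'i^'i \<Rightarrow> 'i tensor" where
  "mult_map_adj blk \<psi> x = (THE t. t \<in> tensor_space blk \<and>
     (\<forall>s\<in>tensor_space blk. tensor_inner \<psi> s t = psi_inner \<psi> (mult_map s) x))"

definition mult_coisometric :: "('i::finite \<Rightarrow> 'a) \<Rightarrow> (complex^'i^'i \<Rightarrow> complex) \<Rightarrow> bool" where
  "mult_coisometric blk \<psi> \<longleftrightarrow> (\<forall>x\<in>block_algebra blk. mult_map (mult_map_adj blk \<psi> x) = x)"

text \<open>\<open>\<psi>(x) = \<Sum>\<^sub>\<alpha> Tr(\<rho>\<^sub>\<alpha>\<^sup>-\<^sup>1) Tr(\<rho>\<^sub>\<alpha> x\<^sub>\<alpha>)\<close>; for block diagonal matrices inverse and product are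
  computed blockwise. This determines \<open>\<rho>\<close> only up to a positive scalar in each block, which
  \<open>modular\<close> below does not see.\<close>

definition is_density ::
  "('i::finite \<Rightarrow> 'a) \<Rightarrow> (complex^'i^'i \<Rightarrow> complex) \<Rightarrow> complex^'i^'i \<Rightarrow> bool" where
  "is_density blk \<psi> \<rho> \<longleftrightarrow> \<rho> \<in> block_algebra blk \<and> pos_def \<rho> \<and>
     (\<forall>x\<in>block_algebra blk.
        \<psi> x = (\<Sum>\<alpha>\<in>range blk. block_trace blk \<alpha> (matrix_inv \<rho>) * block_trace blk \<alpha> (\<rho> ** x)))"

text \<open>The projections of \<open>B \<otimes> B\<^sup>o\<^sup>p\<close>.\<close>

definition op_projections :: "('i::finite \<Rightarrow> 'a) \<Rightarrow> 'i tensor set" where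
  "op_projections blk = {P \<in> tensor_space blk. op_mult P P = P \<and> tensor_adj P = P}"

section \<open>The bimodule of a projection\<close>

text \<open>\<open>\<sigma>\<^sub>z(x) = \<rho>\<^sup>-\<^sup>i\<^sup>z x \<rho>\<^sup>i\<^sup>z\<close> for the modular group of \<open>\<psi>\<^sup>-\<^sup>1\<close>.\<close>

definition modular ::
  "(complex^'i::finite^'i \<Rightarrow> ('h::complex_hilbert_space \<Rightarrow> 'h)) \<Rightarrow> complex^'i^'i \<Rightarrow> complex \<Rightarrow>
   ('h \<Rightarrow> 'h) \<Rightarrow> ('h \<Rightarrow> 'h)" where
  "modular \<pi> \<rho> z x = \<pi> (mat_powr \<rho> (- \<i> * z)) \<circ> x \<circ> \<pi> (mat_powr \<rho> (\<i> * z))"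

text \<open>The linear extension of \<open>b \<otimes> c\<^sup>o\<^sup>p \<mapsto> (x \<mapsto> b x \<sigma>\<^bsub>-i/2\<^esub>(c))\<close>, written in matrix units.\<close>

definition Phi ::
  "(complex^'i::finite^'i \<Rightarrow> ('h::complex_hilbert_space \<Rightarrow> 'h)) \<Rightarrow> complex^'i^'i \<Rightarrow> 'i tensor \<Rightarrow>
   ('h \<Rightarrow> 'h) \<Rightarrow> ('h \<Rightarrow> 'h)" where
  "Phi \<pi> \<rho> P x = (\<lambda>v. \<Sum>i\<in>UNIV. \<Sum>j\<in>UNIV. \<Sum>k\<in>UNIV. \<Sum>l\<in>UNIV.
     P i j k l *\<^sub>C (\<pi> (matrix_unit i j) \<circ> x \<circ> modular \<pi> \<rho> (- \<i> / 2) (\<pi> (matrix_unit k l))) v)"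

definition V_of ::
  "(complex^'i::finite^'i \<Rightarrow> ('h::complex_hilbert_space \<Rightarrow> 'h)) \<Rightarrow> complex^'i^'i \<Rightarrow> 'i tensor \<Rightarrow>
   ('h \<Rightarrow> 'h) set" where
  "V_of \<pi> \<rho> P = modular \<pi> \<rho> (\<i> / 4) ` (Phi \<pi> \<rho> P ` bounded_ops)"

end

theory Submission
  imports Defs
begin

text \<open>View an element of \<open>B \<otimes> B\<^sup>o\<^sup>p\<close> as acting on \<open>B(H)\<close> by \<open>(b \<otimes> c) \<cdot> T = b T c\<close>, and put
  \<open>R = \<rho>\<^sup>1\<^sup>/\<^sup>4 \<otimes> \<rho>\<^sup>1\<^sup>/\<^sup>4\<close>, a self-adjoint invertible element. Then \<open>V\<^sub>P = (R P) \<cdot> B(H)\<close>, which equals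
  \<open>{T. ((1 - P) R\<^sup>-\<^sup>1) \<cdot> T = 0}\<close>; this is a weak* closed bimodule. The action is faithful, so equal
  ranges give \<open>P Q = Q\<close> and \<open>Q P = P\<close>, and self-adjointness forces \<open>P = Q\<close>.

  Conversely, the annihilator \<open>N\<close> of a weak* closed bimodule \<open>V\<close> is a left ideal, and \<open>N R\<close>, being a
  left ideal of a finite dimensional \<open>*\<close>-algebra, is generated by a projection \<open>1 - P\<close>. It remains to
  see that every \<open>T\<close> annihilated by \<open>N\<close> lies in \<open>V\<close>. Compressing \<open>T\<close> on both sides by amplified
  rank one operators, which lie in \<open>B'\<close>, reduces this to the duality between a finite dimensional
  space of coefficients and its annihilator; amplified finite rank projections then approximate \<open>T\<close>
  in the weak* topology. For the flip, \<open>(x \<cdot> T)\<^sup>* = \<Sigma>(x\<^sup>*) \<cdot> T\<^sup>*\<close> and \<open>\<Sigma>(R) = R\<close>.\<close>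

section \<open>Complex Hilbert spaces\<close>

lemma scaleC_one [simp]: "(1::complex) *\<^sub>C x = x"
  using scaleR_scaleC[of 1 x] by simp

lemma scaleC_zero_left [simp]: "(0::complex) *\<^sub>C x = 0"
  using scaleR_scaleC[of 0 x] by simp

lemma scaleC_zero_right [simp]: "c *\<^sub>C (0::'h::complex_hilbert_space) = 0"
  using scaleC_add_right[of c 0 "0::'h"] by simp

lemma scaleC_minus_one: "(-1) *\<^sub>C x = - x"
  using scaleR_scaleC[of "-1" x] by simp

lemma scaleC_minus_left: "(-c) *\<^sub>C x = - (c *\<^sub>C x)"
  by (metis mult_minus1 scaleC_minus_one scaleC_scaleC)

lemma scaleC_diff_left: "(c - d) *\<^sub>C x = c *\<^sub>C x - d *\<^sub>C x"
  by (metis scaleC_add_left scaleC_minus_left uminus_add_conv_diff add.commute)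

lemma scaleC_sum_right: "c *\<^sub>C (\<Sum>i\<in>I. f i) = (\<Sum>i\<in>I. c *\<^sub>C f i)"
  by (induction I rule: infinite_finite_induct) (auto simp: scaleC_add_right)

lemma scaleC_sum_left: "(\<Sum>i\<in>I. c i) *\<^sub>C x = (\<Sum>i\<in>I. c i *\<^sub>C x)"
  by (induction I rule: infinite_finite_induct) (auto simp: scaleC_add_left)

lemma cinner_zero_right [simp]: "cinner x 0 = 0"
  using cinner_scaleC_right[of x 0 0] by simp

lemma cinner_zero_left [simp]: "cinner 0 x = 0"
  using cinner_commute[of 0 x] by simp

lemma cinner_add_left: "cinner (x + y) z = cinner x z + cinner y z"
  by (metis cinner_add_right cinner_commute complex_cnj_add)

lemma cinner_scaleC_left: "cinner (c *\<^sub>C x) y = cnj c * cinner x y"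
  by (metis cinner_commute cinner_scaleC_right complex_cnj_mult)

lemma cinner_minus_right: "cinner x (- y) = - cinner x y"
  using cinner_scaleC_right[of x "-1" y] by (simp add: scaleC_minus_one)

lemma cinner_minus_left: "cinner (- x) y = - cinner x y"
  using cinner_scaleC_left[of "-1" x y] by (simp add: scaleC_minus_one)

lemma cinner_diff_right: "cinner x (y - z) = cinner x y - cinner x z"
  using cinner_add_right[of x y "- z"] by (simp add: cinner_minus_right)

lemma cinner_diff_left: "cinner (x - y) z = cinner x z - cinner y z"
  using cinner_add_left[of x "- y" z] by (simp add: cinner_minus_left)

lemma cinner_sum_right: "cinner x (\<Sum>i\<in>I. f i) = (\<Sum>i\<in>I. cinner x (f i))"
  by (induction I rule: infinite_finite_induct) (auto simp: cinner_add_right)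

lemma cinner_sum_left: "cinner (\<Sum>i\<in>I. f i) x = (\<Sum>i\<in>I. cinner (f i) x)"
  by (induction I rule: infinite_finite_induct) (auto simp: cinner_add_left)

lemmas cinner_simps = cinner_add_left cinner_add_right cinner_diff_left cinner_diff_right
  cinner_scaleC_left cinner_scaleC_right

lemma cinner_eq_zero_iff [simp]: "cinner x x = 0 \<longleftrightarrow> x = 0"
  by (simp add: cinner_norm)

lemma cinner_ext_right:
  assumes "\<And>x. cinner x y = cinner x z"
  shows "y = z"
  using assms[of "y - z"] cinner_eq_zero_iff[of "y - z"] by (simp add: cinner_diff_right)

lemma cinner_ext_left:
  assumes "\<And>x. cinner y x = cinner z x"
  shows "y = z"
  using assms[of "y - z"] cinner_eq_zero_iff[of "y - z"] by (simp add: cinner_diff_left)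

text \<open>Polarisation: it gives Pythagoras for orthogonal vectors and, combined with the case of
  \<open>x - y\<close>, the parallelogram law.\<close>

lemma norm_add_square: "(norm (x + y))\<^sup>2 = (norm x)\<^sup>2 + (norm y)\<^sup>2 + 2 * Re (cinner x y)"
proof -
  have "complex_of_real ((norm (x + y))\<^sup>2) = cinner (x + y) (x + y)"
    by (simp add: cinner_norm)
  also have "\<dots> = cinner x x + cinner y y + (cinner x y + cnj (cinner x y))"
    using cinner_commute[of y x] by (simp add: cinner_simps)
  also have "\<dots> = complex_of_real ((norm x)\<^sup>2 + (norm y)\<^sup>2 + 2 * Re (cinner x y))"
    by (simp add: cinner_norm complex_add_cnj)
  finally show ?thesis
    by (simp only: of_real_eq_iff)
qed

lemma norm_scaleC: "norm (c *\<^sub>C x) = cmod c * norm x"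
proof -
  have "complex_of_real ((norm (c *\<^sub>C x))\<^sup>2) = cnj c * c * complex_of_real ((norm x)\<^sup>2)"
    by (metis cinner_norm cinner_scaleC_left cinner_scaleC_right mult.assoc)
  also have "\<dots> = complex_of_real ((cmod c * norm x)\<^sup>2)"
    by (simp add: power_mult_distrib mult.commute[of "cnj c"] complex_norm_square del: of_real_power)
  finally have "(norm (c *\<^sub>C x))\<^sup>2 = (cmod c * norm x)\<^sup>2"
    by (simp only: of_real_eq_iff)
  then show ?thesis
    by (simp add: power2_eq_iff_nonneg)
qed

lemma cinner_Cauchy_Schwarz: "cmod (cinner x y) \<le> norm x * norm y"
proof (cases "x = 0")
  case False
  \<comment> \<open>The coefficient of the orthogonal projection of \<open>y\<close> onto
    \<open>x\<close>; Pythagoras then bounds the length of \<open>c x\<close> by that of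
    \<open>y\<close>.\<close>
  define c where "c = cinner x y / complex_of_real ((norm x)\<^sup>2)"
  have 0: "cinner x (y - c *\<^sub>C x) = 0"
    using False by (simp add: c_def cinner_simps cinner_norm)
  have "(norm y)\<^sup>2 = (norm ((y - c *\<^sub>C x) + c *\<^sub>C x))\<^sup>2"
    by simp
  also have "\<dots> = (norm (y - c *\<^sub>C x))\<^sup>2 + (norm (c *\<^sub>C x))\<^sup>2"
    unfolding norm_add_square using 0 cinner_commute[of "y - c *\<^sub>C x" x]
    by (simp add: cinner_scaleC_right)
  finally have "(norm (c *\<^sub>C x))\<^sup>2 \<le> (norm y)\<^sup>2"
    by simp
  then have "norm (c *\<^sub>C x) \<le> norm y"
    by (simp add: power2_le_iff_abs_le)
  moreover have "norm (c *\<^sub>C x) = cmod (cinner x y) / norm x"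
    using False by (simp add: norm_scaleC c_def norm_divide norm_mult power2_eq_square)
  ultimately show ?thesis
    using False by (simp add: field_simps)
qed simp

section \<open>Bounded linear functionals and the Riesz representation\<close>

lemma cinner_scaleR_right: "cinner x (r *\<^sub>R y) = complex_of_real r * cinner x y"
  by (simp add: scaleR_scaleC cinner_scaleC_right)

lemma bounded_linear_cinner_right: "bounded_linear (cinner x)"
proof (rule bounded_linear_intro[where K = "norm x"])
  show "norm (cinner x y) \<le> norm y * norm x" for y
    using cinner_Cauchy_Schwarz[of x y] by (simp add: mult.commute)
qed (auto simp: cinner_add_right scaleR_scaleC cinner_scaleC_right scaleR_conv_of_real)

lemma bounded_linear_scaleC_right:
  "bounded_linear (\<lambda>x::'h::complex_hilbert_space. c *\<^sub>C x)"
proof (rule bounded_linear_intro[where K = "cmod c"])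
  show "norm (c *\<^sub>C x) \<le> norm x * cmod c" for x :: 'h
    by (simp add: norm_scaleC mult.commute)
qed (auto simp: scaleC_add_right scaleR_scaleC scaleC_scaleC mult.commute)

text \<open>The representing vector minimises \<open>\<parallel>x\<parallel>\<^sup>2 - 2 g x\<close>.\<close>

lemma real_riesz:
  fixes g :: "'h::complex_hilbert_space \<Rightarrow> real"
  assumes "bounded_linear g"
  shows "\<exists>x. \<forall>y. Re (cinner x y) = g y"
proof -
  interpret g: bounded_linear g by fact
  obtain K where K: "\<And>x. norm (g x) \<le> norm x * K"
    using g.bounded by blast
  define J where "J x = (norm x)\<^sup>2 - 2 * g x" for x
  have J_ge: "- K\<^sup>2 \<le> J x" for x
  proof -
    have "g x \<le> norm x * K" using K[of x] by simp
    then show ?thesis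
      using zero_le_power2[of "norm x - K"] by (simp add: J_def power2_diff)
  qed
  define m where "m = Inf (range J)"
  have bdd: "bdd_below (range J)"
    using J_ge by (auto intro!: bdd_belowI)
  have m_le: "m \<le> J x" for x
    unfolding m_def using bdd by (simp add: cInf_lower)
  have "\<exists>x. J x < m + inverse (real (Suc n))" for n
  proof -
    have "m < m + inverse (real (Suc n))" by simp
    then show ?thesis
      unfolding m_def by (subst (asm) cInf_less_iff) (use bdd in auto)
  qed
  then obtain X where X: "\<And>n. J (X n) < m + inverse (real (Suc n))"
    by metis
  \<comment> \<open>Parallelogram law written for \<open>J\<close>, where the linear parts cancel.
    Two near-minimisers are close, since \<open>J\<close> at their midpoint is at least
    \<open>m\<close>.\<close>
  have par: "(norm (x - y))\<^sup>2 = 2 * J x + 2 * J y - 4 * J ((1/2) *\<^sub>R (x + y))" for x y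
  proof -
    have "4 * J ((1/2) *\<^sub>R (x + y)) = (norm (x + y))\<^sup>2 - 4 * (g x + g y)"
      by (simp add: J_def g.scaleR g.add power_divide add_divide_distrib del: scaleR_add_right)
    then show ?thesis
      using norm_add_square[of x y] norm_add_square[of x "- y"]
      by (simp add: J_def cinner_minus_right)
  qed
  have dist: "(norm (X n - X k))\<^sup>2 \<le> 4 * inverse (real (Suc N))" if "n \<ge> N" "k \<ge> N" for n k N
  proof -
    have le: "J (X n) < m + inverse (real (Suc N))" if "n \<ge> N" for n
    proof -
      have "inverse (real (Suc n)) \<le> inverse (real (Suc N))"
        using that by (intro le_imp_inverse_le) auto
      then show ?thesis using X[of n] by linarith
    qed
    show ?thesis
      using le[OF that(1)] le[OF that(2)] m_le[of "(1/2) *\<^sub>R (X n + X k)"]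
      unfolding par by linarith
  qed
  have "Cauchy X"
  proof (rule metric_CauchyI)
    fix e :: real assume "e > 0"
    then have "e\<^sup>2 / 4 > 0" by simp
    then obtain N where N: "inverse (real (Suc N)) < e\<^sup>2 / 4"
      using reals_Archimedean by blast
    have "dist (X n) (X k) < e" if "n \<ge> N" "k \<ge> N" for n k
    proof -
      have "(norm (X n - X k))\<^sup>2 < e\<^sup>2"
        using dist[OF that] N by simp
      then show ?thesis
        using \<open>e > 0\<close> by (simp add: dist_norm power_less_imp_less_base)
    qed
    then show "\<exists>M. \<forall>n\<ge>M. \<forall>k\<ge>M. dist (X n) (X k) < e" by blast
  qed
  then obtain x where x: "X \<longlonglongrightarrow> x"
    using Cauchy_convergent convergent_def by blast
  have "(\<lambda>n. J (X n)) \<longlonglongrightarrow> J x"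
    unfolding J_def by (intro tendsto_intros x g.tendsto)
  moreover have "(\<lambda>n. m + inverse (real (Suc n))) \<longlonglongrightarrow> m + 0"
    by (intro tendsto_intros LIMSEQ_inverse_real_of_nat)
  ultimately have "J x \<le> m"
    using X by (intro LIMSEQ_le[where X = "\<lambda>n. J (X n)" and Y = "\<lambda>n. m + inverse (real (Suc n))"])
      (auto intro: less_imp_le)
  then have min: "J x \<le> J y" for y
    using m_le[of y] by simp
  have "Re (cinner x y) = g y" for y
  proof (rule ccontr)
    define d where "d = Re (cinner x y) - g y"
    assume "Re (cinner x y) \<noteq> g y"
    then have "d \<noteq> 0" by (simp add: d_def)
    have quad: "0 \<le> 2 * t * d + t\<^sup>2 * (norm y)\<^sup>2" for t
    proof -
      have "J (x + t *\<^sub>R y) = J x + 2 * t * d + t\<^sup>2 * (norm y)\<^sup>2"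
        unfolding J_def norm_add_square
        by (simp add: g.add g.scaleR d_def cinner_scaleR_right power_mult_distrib algebra_simps)
      then show ?thesis
        using min[of "x + t *\<^sub>R y"] by simp
    qed
    \<comment> \<open>With \<open>t = - d s\<close> the variation becomes
      \<open>- d^2 s (2 - s |y|^2)\<close>, which is negative. The summand 1 keeps the denominator
      positive when \<open>y = 0\<close>.\<close>
    define s where "s = 1 / ((norm y)\<^sup>2 + 1)"
    have "(norm y)\<^sup>2 + 1 > 0"
      by (simp add: add_nonneg_pos)
    then have s: "s > 0" "s * (norm y)\<^sup>2 < 1"
      by (simp_all add: s_def divide_less_eq)
    have "0 \<le> - (d\<^sup>2 * s) * (2 - s * (norm y)\<^sup>2)"
      using quad[of "- d * s"] by (simp add: power2_eq_square algebra_simps)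
    moreover have "d\<^sup>2 * s * (2 - s * (norm y)\<^sup>2) > 0"
      using s \<open>d \<noteq> 0\<close> by (intro mult_pos_pos) auto
    ultimately show False by simp
  qed
  then show ?thesis by blast
qed

section \<open>Bounded operators and adjoints\<close>

lemma bounded_opsD:
  assumes "T \<in> bounded_ops"
  shows "bounded_linear T" "T (c *\<^sub>C x) = c *\<^sub>C T x" "T (x + y) = T x + T y" "T 0 = 0"
    "T (x - y) = T x - T y" "T (sum f I) = (\<Sum>i\<in>I. T (f i))"
proof -
  show bl: "bounded_linear T" and "T (c *\<^sub>C x) = c *\<^sub>C T x"
    using assms by (auto simp: bounded_ops_def)
  interpret T: bounded_linear T by fact
  show "T (x + y) = T x + T y" "T 0 = 0" "T (x - y) = T x - T y" "T (sum f I) = (\<Sum>i\<in>I. T (f i))"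
    by (rule T.add T.zero T.diff T.sum)+
qed

lemma bounded_ops_comp: "S \<in> bounded_ops \<Longrightarrow> T \<in> bounded_ops \<Longrightarrow> (\<lambda>v. S (T v)) \<in> bounded_ops"
  by (auto simp: bounded_ops_def bounded_linear_compose)

lemma bounded_ops_o: "S \<in> bounded_ops \<Longrightarrow> T \<in> bounded_ops \<Longrightarrow> S \<circ> T \<in> bounded_ops"
  using bounded_ops_comp[of S T] by (simp add: comp_def)

lemma bounded_ops_zero: "(\<lambda>v. 0) \<in> bounded_ops"
  by (auto simp: bounded_ops_def bounded_linear_zero)

lemma bounded_ops_add:
  "S \<in> bounded_ops \<Longrightarrow> T \<in> bounded_ops \<Longrightarrow> (\<lambda>v. S v + T v) \<in> bounded_ops"
  by (auto simp: bounded_ops_def bounded_linear_add scaleC_add_right)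

lemma bounded_ops_scaleC: "T \<in> bounded_ops \<Longrightarrow> (\<lambda>v. c *\<^sub>C T v) \<in> bounded_ops"
  by (auto simp: bounded_ops_def scaleC_scaleC mult.commute
      intro: bounded_linear_compose[OF bounded_linear_scaleC_right])

lemma bounded_ops_sum:
  "(\<And>i. i \<in> I \<Longrightarrow> f i \<in> bounded_ops) \<Longrightarrow> (\<lambda>v. \<Sum>i\<in>I. f i v) \<in> bounded_ops"
  by (induction I rule: infinite_finite_induct) (auto intro: bounded_ops_zero bounded_ops_add)

text \<open>In bra-ket notation this is \<open>|x><y|\<close>, so passing to the adjoint exchanges
  the two vectors.\<close>

definition rank_one :: "'h::complex_hilbert_space \<Rightarrow> 'h \<Rightarrow> 'h \<Rightarrow> 'h" where
  "rank_one x y v = cinner y v *\<^sub>C x"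

lemma rank_one_bounded: "rank_one x y \<in> bounded_ops"
  unfolding bounded_ops_def
proof (intro CollectI conjI allI)
  show "bounded_linear (rank_one x y)"
  proof (rule bounded_linear_intro[where K = "norm x * norm y"])
    show "norm (rank_one x y v) \<le> norm v * (norm x * norm y)" for v
      using mult_right_mono[OF cinner_Cauchy_Schwarz[of y v] norm_ge_zero[of x]]
      by (simp add: rank_one_def norm_scaleC mult_ac)
  qed (auto simp: rank_one_def cinner_add_right scaleC_add_left scaleR_scaleC cinner_scaleC_right
      scaleC_scaleC)
  show "rank_one x y (c *\<^sub>C v) = c *\<^sub>C rank_one x y v" for c v
    by (simp add: rank_one_def cinner_scaleC_right scaleC_scaleC)
qed

lemma cinner_rank_one: "cinner z (rank_one x y v) = cinner z x * cinner y v"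
  by (simp add: rank_one_def cinner_scaleC_right)

lemma cinner_rank_one_left: "cinner (rank_one x y v) z = cinner v (rank_one y x z)"
  by (simp add: rank_one_def cinner_scaleC_right cinner_scaleC_left cinner_commute[of v y] mult.commute)

lemma adjoint_exists:
  fixes T :: "'h::complex_hilbert_space \<Rightarrow> 'h"
  assumes T: "T \<in> bounded_ops"
  obtains S where "S \<in> bounded_ops" "\<And>x y. cinner (S x) y = cinner x (T y)"
proof -
  have "\<exists>z. \<forall>y. cinner z y = cinner x (T y)" for x
  proof -
    have "bounded_linear (\<lambda>y. Re (cinner x (T y)))"
      by (intro bounded_linear_compose[OF bounded_linear_Re]
          bounded_linear_compose[OF bounded_linear_cinner_right] bounded_opsD T)
    from real_riesz[OF this] obtain z where z: "\<And>y. Re (cinner z y) = Re (cinner x (T y))"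
      by blast
    \<comment> \<open>Riesz was applied to the real part only; testing on \<open>i y\<close> instead
      of \<open>y\<close> recovers the imaginary part.\<close>
    have "Im (cinner z y) = Im (cinner x (T y))" for y
      using z[of "\<i> *\<^sub>C y"] by (simp add: cinner_scaleC_right bounded_opsD[OF T])
    then show ?thesis using z by (auto simp: complex_eq_iff)
  qed
  then obtain S where S: "\<And>x y. cinner (S x) y = cinner x (T y)" by metis
  obtain K where K: "\<And>x. norm (T x) \<le> norm x * K" "K \<ge> 0"
    using bounded_linear.nonneg_bounded[OF bounded_opsD(1)[OF T]] by blast
  have add: "S (x + y) = S x + S y" for x y
    by (rule cinner_ext_left) (simp add: S cinner_add_left)
  have sc: "S (c *\<^sub>C x) = c *\<^sub>C S x" for c x
    by (rule cinner_ext_left) (simp add: S cinner_scaleC_left)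
  have "norm (S x) \<le> norm x * K" for x
  proof (cases "S x = 0")
    case False
    \<comment> \<open>The bound for \<open>S\<close> follows from that for \<open>T\<close> by
      testing the adjoint relation at \<open>y = S x\<close> and cancelling one factor.\<close>
    have "(norm (S x))\<^sup>2 = cmod (cinner x (T (S x)))"
      unfolding S[symmetric] cinner_norm by (simp only: norm_of_real abs_of_nonneg zero_le_power2)
    also have "\<dots> \<le> norm x * (norm (S x) * K)"
      using cinner_Cauchy_Schwarz[of x "T (S x)"] mult_left_mono[OF K(1)[of "S x"] norm_ge_zero[of x]]
      by linarith
    finally show ?thesis
      using False by (simp add: power2_eq_square mult_ac)
  qed (use K in simp)
  then have "bounded_linear S"
    by (intro bounded_linear_intro) (auto simp: add sc scaleR_scaleC)
  then show ?thesis
    using that[of S] S sc by (auto simp: bounded_ops_def)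
qed

lemma op_adj_eqI:
  assumes "S \<in> bounded_ops" "\<And>x y. cinner (S x) y = cinner x (T y)"
  shows "op_adj T = S"
  unfolding op_adj_def
proof (rule the_equality)
  fix S' assume "S' \<in> bounded_ops \<and> (\<forall>x y. cinner (S' x) y = cinner x (T y))"
  then show "S' = S"
    using assms(2) by (intro ext cinner_ext_left) simp
qed (use assms in blast)

lemma op_adj_bounded: "T \<in> bounded_ops \<Longrightarrow> op_adj T \<in> bounded_ops"
  and cinner_op_adj_left: "T \<in> bounded_ops \<Longrightarrow> cinner (op_adj T x) y = cinner x (T y)"
  by (metis adjoint_exists op_adj_eqI)+

lemma cinner_op_adj_right: "T \<in> bounded_ops \<Longrightarrow> cinner x (op_adj T y) = cinner (T x) y"
  by (metis cinner_commute cinner_op_adj_left)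

lemma op_adj_op_adj: "T \<in> bounded_ops \<Longrightarrow> op_adj (op_adj T) = T"
  by (rule op_adj_eqI) (simp_all add: cinner_op_adj_right)

text \<open>Gram--Schmidt: \<open>\<Sum>u\<in>U. rank_one u u\<close> is the projection onto a space containing \<open>A\<close>.\<close>

lemma finite_orthonormal_set:
  fixes A :: "'h::complex_hilbert_space set"
  assumes "finite A"
  obtains U where "finite U" "\<And>u v. u \<in> U \<Longrightarrow> v \<in> U \<Longrightarrow> cinner u v = (if u = v then 1 else 0)"
    "\<And>a. a \<in> A \<Longrightarrow> (\<Sum>u\<in>U. rank_one u u a) = a"
proof -
  have "\<exists>U. finite U \<and> (\<forall>u\<in>U. \<forall>v\<in>U. cinner u v = (if u = v then 1 else 0)) \<and>
    (\<forall>a\<in>A. (\<Sum>u\<in>U. rank_one u u a) = a)"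
    using assms
  proof (induction A rule: finite_induct)
    case empty
    then show ?case by (intro exI[of _ "{}"]) auto
  next
    case (insert a A)
    then obtain U where U: "finite U" "\<forall>u\<in>U. \<forall>v\<in>U. cinner u v = (if u = v then 1 else 0)"
      "\<forall>a\<in>A. (\<Sum>u\<in>U. rank_one u u a) = a" by blast
    \<comment> \<open>The residual of \<open>a\<close>, orthogonal to \<open>U\<close>. If it is
      nonzero, its normalisation \<open>w\<close> is the new basis vector.\<close>
    define b where "b = a - (\<Sum>u\<in>U. rank_one u u a)"
    have orth: "cinner u b = 0" if "u \<in> U" for u
      using U that
      by (simp add: b_def cinner_diff_right cinner_sum_right cinner_rank_one if_distrib[of "\<lambda>z. z * _"]
          cong: if_cong)
    show ?case
    proof (cases "b = 0")
      case True
      then show ?thesis using U by (intro exI[of _ U]) (auto simp: b_def)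
    next
      case False
      define w where "w = complex_of_real (inverse (norm b)) *\<^sub>C b"
      have w1: "cinner w w = 1"
        using False by (simp add: w_def cinner_scaleC_left cinner_scaleC_right cinner_norm[of b]
            power2_eq_square mult.assoc[symmetric])
      have wu: "cinner u w = 0" "cinner w u = 0" if "u \<in> U" for u
        using orth[OF that] cinner_commute[of b u] by (auto simp: w_def cinner_simps)
      have "w \<notin> U" using wu w1 by force
      \<comment> \<open>\<open>a\<close> differs from \<open>b\<close> by a vector orthogonal to
        \<open>b\<close>, so projecting \<open>a\<close> onto the line of \<open>b\<close> returns
        \<open>b\<close> itself.\<close>
      have aw: "rank_one w w a = b"
      proof -
        have "cinner b u = 0" if "u \<in> U" for u
          using orth[OF that] cinner_commute[of b u] by simp
        then have "cinner b (b + (\<Sum>u\<in>U. rank_one u u a)) = cinner b b"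
          by (simp add: cinner_add_right cinner_sum_right cinner_rank_one)
        moreover have "b + (\<Sum>u\<in>U. rank_one u u a) = a"
          by (simp add: b_def)
        ultimately have "cinner b a = cinner b b"
          by simp
        then show ?thesis
          using False
          by (simp add: rank_one_def w_def cinner_scaleC_left scaleC_scaleC cinner_norm[of b]
              power2_eq_square mult.assoc[symmetric])
      qed
      have wA: "rank_one w w x = 0" if "x \<in> A" for x
      proof -
        have "cinner w x = cinner w (\<Sum>u\<in>U. rank_one u u x)" using U that by simp
        also have "\<dots> = 0" using wu by (simp add: cinner_sum_right cinner_rank_one)
        finally show ?thesis by (simp add: rank_one_def)
      qed
      show ?thesis
        using U w1 wu \<open>w \<notin> U\<close> aw wA
        by (intro exI[of _ "insert w U"]) (auto simp: b_def)
    qed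
  qed
  then show ?thesis using that by blast
qed

text \<open>For the projected vector \<open>y\<close> one has \<open><y, x> = <y, y>\<close>; apply
  Cauchy-Schwarz to the left side.\<close>

lemma bessel:
  assumes "finite U" "\<And>u v. u \<in> U \<Longrightarrow> v \<in> U \<Longrightarrow> cinner u v = (if u = v then 1 else 0)"
  shows "norm (\<Sum>u\<in>U. rank_one u u x) \<le> norm x"
proof -
  define y where "y = (\<Sum>u\<in>U. rank_one u u x)"
  have uy: "cinner u y = cinner u x" if "u \<in> U" for u
    using assms that
    by (simp add: y_def cinner_sum_right cinner_rank_one if_distrib[of "\<lambda>z. z * _"] cong: if_cong)
  have "cinner y x = cinner y y"
  proof -
    have "cinner y z = (\<Sum>u\<in>U. cnj (cinner u x) * cinner u z)" for z
      by (simp add: y_def cinner_sum_left rank_one_def cinner_scaleC_left)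
    then show ?thesis by (simp add: uy)
  qed
  then have "(norm y)\<^sup>2 = cmod (cinner y x)"
    by (simp only: cinner_norm norm_of_real abs_of_nonneg zero_le_power2)
  also have "\<dots> \<le> norm y * norm x" by (rule cinner_Cauchy_Schwarz)
  finally have "norm y \<le> norm x"
    by (cases "norm y = 0") (auto simp: power2_eq_square mult_le_cancel_left)
  then show ?thesis by (simp add: y_def)
qed

section \<open>Powers of positive definite matrices\<close>

text \<open>The Hermitian inner product. Its real part is the Euclidean inner product, which lets
  real orthogonality arguments be used for complex vectors.\<close>

definition csp :: "complex^'i::finite \<Rightarrow> complex^'i \<Rightarrow> complex" where
  "csp v w = (\<Sum>i\<in>UNIV. cnj (v $ i) * w $ i)"

lemma inner_eq_Re_csp: "v \<bullet> w = Re (csp v w)"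
  by (simp add: csp_def inner_vec_def inner_complex_def)

lemma csp_scale: "csp v (c *s w) = c * csp v w" "csp (c *s v) w = cnj c * csp v w"
  by (simp_all add: csp_def sum_distrib_left mult_ac)

lemma csp_add_left: "csp (v + v') w = csp v w + csp v' w"
  by (simp add: csp_def algebra_simps sum.distrib)

lemma csp_mat_adj: "csp (mat_adj a *v v) w = csp v (a *v w)"
proof -
  have "csp (mat_adj a *v v) w = (\<Sum>i\<in>UNIV. \<Sum>j\<in>UNIV. a $ j $ i * cnj (v $ j) * w $ i)"
    by (simp add: csp_def matrix_vector_mult_def mat_adj_def sum_distrib_right)
  also have "\<dots> = (\<Sum>j\<in>UNIV. \<Sum>i\<in>UNIV. a $ j $ i * cnj (v $ j) * w $ i)"
    by (rule sum.swap)
  also have "\<dots> = csp v (a *v w)"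
    by (simp add: csp_def matrix_vector_mult_def sum_distrib_left mult_ac)
  finally show ?thesis .
qed

lemma csp_ext:
  assumes "\<And>v. csp v w = csp v w'"
  shows "w = w'"
proof -
  have "(w - w') \<bullet> w = (w - w') \<bullet> w'"
    using assms by (simp add: inner_eq_Re_csp)
  then have "(w - w') \<bullet> (w - w') = 0"
    by (subst inner_diff_right) simp
  then show ?thesis
    by simp
qed

lemma mat_adj_mat_adj [simp]: "mat_adj (mat_adj x) = x"
  by (simp add: mat_adj_def vec_eq_iff)

lemma mat_adj_mult: "mat_adj (x ** y) = mat_adj y ** mat_adj (x :: complex^'i::finite^'i)"
  by (simp add: mat_adj_def vec_eq_iff matrix_matrix_mult_def mult.commute)

text \<open>On the unit sphere of the orthogonal complement of the eigenvectors the quadratic form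
  attains its maximum, necessarily at an eigenvector.\<close>

lemma symmetric_eigenvectors_span:
  fixes f :: "'a::euclidean_space \<Rightarrow> 'a"
  assumes lin: "linear f" and sym: "\<And>x y. f x \<bullet> y = x \<bullet> f y"
  shows "span {v. \<exists>l. f v = l *\<^sub>R v} = UNIV"
proof (rule ccontr)
  interpret f: linear f by fact
  let ?E = "{v. \<exists>l. f v = l *\<^sub>R v}"
  define W where "W = {w. \<forall>v\<in>?E. v \<bullet> w = 0}"
  assume "span ?E \<noteq> UNIV"
  then obtain x where x: "x \<notin> span ?E" by blast
  obtain y z where yz: "y \<in> span ?E" "\<And>w. w \<in> span ?E \<Longrightarrow> orthogonal z w" "x = y + z"
    using orthogonal_subspace_decomp_exists[of ?E x] by blast
  have "z \<noteq> 0" using x yz by auto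
  have W_scale: "c *\<^sub>R w \<in> W" if "w \<in> W" for c w
    using that by (auto simp: W_def)
  have W_add: "v + w \<in> W" if "v \<in> W" "w \<in> W" for v w
    using that by (auto simp: W_def inner_add_right)
  have Wf: "f w \<in> W" if "w \<in> W" for w
  proof -
    have "v \<bullet> f w = 0" if "f v = l *\<^sub>R v" for v l
    proof -
      have "v \<bullet> f w = l * (v \<bullet> w)" using sym[of v w] that by simp
      also have "v \<bullet> w = 0" using \<open>w \<in> W\<close> that unfolding W_def by blast
      finally show ?thesis by simp
    qed
    then show ?thesis by (auto simp: W_def)
  qed
  have zW: "z \<in> W"
    using yz(2) by (auto simp: W_def orthogonal_def inner_commute intro: span_base)
  define C where "C = W \<inter> sphere 0 1"
  have "closed W"
  proof -
    have "W = (\<Inter>v\<in>?E. {w. v \<bullet> w = 0})" by (auto simp: W_def)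
    moreover have "closed (\<Inter>v\<in>?E. {w. v \<bullet> w = 0})"
      by (intro closed_INT ballI closed_hyperplane)
    ultimately show ?thesis by simp
  qed
  then have "compact C" unfolding C_def by (intro closed_Int_compact) auto
  moreover have "(1 / norm z) *\<^sub>R z \<in> C"
    using W_scale[OF zW] \<open>z \<noteq> 0\<close> by (simp add: C_def)
  then have "C \<noteq> {}" by blast
  moreover have "continuous_on C (\<lambda>w. w \<bullet> f w)"
    by (intro continuous_intros linear_continuous_on_compose[OF _ lin])
  ultimately obtain w where w: "w \<in> C" "\<And>u. u \<in> C \<Longrightarrow> u \<bullet> f u \<le> w \<bullet> f w"
    using continuous_attains_sup[of C "\<lambda>w. w \<bullet> f w"] by blast
  define m where "m = w \<bullet> f w"
  have ww: "w \<bullet> w = 1" "w \<in> W" using w(1) by (auto simp: C_def norm_eq_1)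
  have le: "u \<bullet> f u \<le> m * (u \<bullet> u)" if "u \<in> W" for u
  proof (cases "u = 0")
    case False
    have "(1 / norm u) *\<^sub>R u \<in> C"
      using W_scale[OF that] False by (simp add: C_def)
    from w(2)[OF this] show ?thesis
      using False by (simp add: m_def f.scale power2_norm_eq_inner[symmetric] field_simps power2_eq_square)
  qed simp
  define d where "d = f w - m *\<^sub>R w"
  have dW: "d \<in> W"
    using W_add[OF Wf[OF ww(2)] W_scale[OF ww(2), of "- m"]] by (simp add: d_def)
  have "d = 0"
  proof (rule ccontr)
    assume "d \<noteq> 0"
    \<comment> \<open>Maximality of the form at \<open>w\<close>, tested along the line
      \<open>w + t d\<close>. The terms of order zero cancel and the linear one is the squared
      length of \<open>d\<close>.\<close>
    have quad: "2 * t * (d \<bullet> d) \<le> t\<^sup>2 * (m * (d \<bullet> d) - d \<bullet> f d)" for t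
    proof -
      have e: "w \<bullet> f d = d \<bullet> f w" using sym[of w d] by (simp add: inner_commute)
      have "(w + t *\<^sub>R d) \<bullet> f (w + t *\<^sub>R d) \<le> m * ((w + t *\<^sub>R d) \<bullet> (w + t *\<^sub>R d))"
        by (intro le W_add W_scale dW ww)
      then have "2 * t * (d \<bullet> f w) + t\<^sup>2 * (d \<bullet> f d) \<le> 2 * t * m * (d \<bullet> w) + t\<^sup>2 * m * (d \<bullet> d)"
        by (simp add: f.add f.scale inner_add_left inner_add_right e ww m_def[symmetric]
            inner_commute[of w d] power2_eq_square algebra_simps)
      moreover have "d \<bullet> d = d \<bullet> f w - m * (d \<bullet> w)"
        by (subst (2) d_def) (simp add: inner_diff_right)
      then have "2 * t * (d \<bullet> d) = 2 * t * (d \<bullet> f w) - 2 * t * m * (d \<bullet> w)"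
        by (simp add: right_diff_distrib)
      ultimately show ?thesis by (simp add: right_diff_distrib mult.assoc)
    qed
    define K where "K = \<bar>m * (d \<bullet> d) - d \<bullet> f d\<bar> + 1"
    \<comment> \<open>As \<open>K\<close> is a positive bound for the quadratic coefficient, this
      choice turns \<open>quad\<close> into \<open>2 t (d . d) <= t (d . d)\<close>, impossible for
      positive \<open>t\<close> and nonzero \<open>d\<close>.\<close>
    define t where "t = (d \<bullet> d) / K"
    have K: "K > 0" by (simp add: K_def)
    have dd: "d \<bullet> d > 0" using \<open>d \<noteq> 0\<close> by simp
    have "m * (d \<bullet> d) - d \<bullet> f d \<le> K" by (simp add: K_def)
    from mult_left_mono[OF this zero_le_power2[of t]]
    have "2 * t * (d \<bullet> d) \<le> t\<^sup>2 * K"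
      using quad[of t] by (rule order_trans[rotated])
    also have "t\<^sup>2 * K = t * (d \<bullet> d)"
      using K by (simp add: t_def power2_eq_square)
    finally have "t * (d \<bullet> d) \<le> 0" by simp
    moreover have "t > 0" using K dd by (simp add: t_def)
    ultimately show False using dd by (simp add: mult_le_0_iff)
  qed
  then have "w \<in> ?E" by (auto simp: d_def)
  then have "w \<bullet> w = 0" using ww(2) unfolding W_def by blast
  with ww show False by simp
qed

section \<open>Eigenvectors and functional calculus of self-adjoint matrices\<close>

definition eigvecs :: "complex^'i::finite^'i \<Rightarrow> (complex^'i) set" where
  "eigvecs r = {v. \<exists>l::real. r *v v = complex_of_real l *s v}"

lemma scaleR_vec_complex: "l *\<^sub>R (v :: complex^'i) = complex_of_real l *s v"
  for l :: real
  by (simp add: vec_eq_iff complex_eq_iff)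

text \<open>A self-adjoint matrix is symmetric for the underlying real inner product, so its
  eigenvectors with real eigenvalue span already over the reals.\<close>

lemma vec_span_eigvecs:
  assumes "mat_adj r = r"
  shows "vec.span (eigvecs r) = UNIV"
proof -
  have lin: "linear ((*v) r)"
    by (auto intro!: linearI simp: matrix_vector_right_distrib scaleR_vec_complex
        vector_scalar_commute)
  have "(r *v v) \<bullet> w = v \<bullet> (r *v w)" for v w
    using csp_mat_adj[of r v w] assms by (simp add: inner_eq_Re_csp)
  then have "span (eigvecs r) = UNIV"
    using symmetric_eigenvectors_span[OF lin] by (simp add: eigvecs_def scaleR_vec_complex)
  moreover have "span (eigvecs r) \<subseteq> vec.span (eigvecs r)"
  proof (rule span_minimal)
    show "subspace (vec.span (eigvecs r))"
      by (auto simp: subspace_def vec.span_zero vec.span_add scaleR_vec_complex vec.span_scale)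
  qed (rule vec.span_superset)
  ultimately show ?thesis by auto
qed

text \<open>This is the uniqueness behind the \<open>THE\<close> in \<open>mat_powr\<close>, and the
  means by which the identities between powers are checked.\<close>

lemma mat_eq_on_eigvecs:
  fixes x y :: "complex^'i::finite^'i"
  assumes "mat_adj r = r" "\<And>l::real. \<And>v. r *v v = complex_of_real l *s v \<Longrightarrow> x *v v = y *v v"
  shows "x = y"
proof -
  have "x *v v = y *v v" for v
  proof (rule vec.linear_eq_on_span[of "(*v) x" "(*v) y" "eigvecs r"])
    show "v \<in> vec.span (eigvecs r)" by (simp add: vec_span_eigvecs assms)
  qed (use assms(2) in \<open>auto simp: eigvecs_def\<close>)
  then show ?thesis by (simp add: matrix_eq)
qed

text \<open>Prescribe the values on a basis of eigenvectors. What needs proof is the behaviour on an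
  arbitrary eigenvector, which need not belong to that basis.\<close>

lemma mat_powr_ex:
  assumes r: "mat_adj r = r"
  shows "\<exists>x. \<forall>l::real. \<forall>v. r *v v = complex_of_real l *s v \<longrightarrow>
    x *v v = (complex_of_real l powr z) *s v"
proof -
  obtain B where B: "B \<subseteq> eigvecs r" "vec.independent B" "vec.span B = vec.span (eigvecs r)"
    using vec.maximal_independent_subset[of "eigvecs r"]
    by (metis vec.span_mono vec.span_span subset_antisym)
  have spanB: "vec.span B = UNIV" using B(3) vec_span_eigvecs[OF r] by simp
  have "\<forall>b\<in>B. \<exists>l::real. r *v b = complex_of_real l *s b" using B(1) by (auto simp: eigvecs_def)
  then obtain ev where ev: "\<And>b. b \<in> B \<Longrightarrow> r *v b = complex_of_real (ev b) *s b" by metis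
  obtain g where g: "Vector_Spaces.linear (*s) (*s) g"
    "\<And>b. b \<in> B \<Longrightarrow> g b = (complex_of_real (ev b) powr z) *s b"
    using vec.linear_independent_extend[OF B(2), of "\<lambda>b. (complex_of_real (ev b) powr z) *s b"]
    by blast
  have "matrix g *v v = (complex_of_real l powr z) *s v" if v: "r *v v = complex_of_real l *s v"
    for l :: real and v
  proof -
    have fB: "finite B" using B(2) vec.finiteI_independent by blast
    have "v \<in> vec.span B" using spanB by simp
    then obtain c where c: "v = (\<Sum>b\<in>B. c b *s b)"
      unfolding vec.span_finite[OF fB] by auto
    \<comment> \<open>Apply \<open>r - l\<close> to the expansion of \<open>v\<close>. It gives 0,
      so by independence only basis vectors with eigenvalue \<open>l\<close> can have a nonzero
      coefficient in \<open>v\<close>.\<close>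
    have "(\<Sum>b\<in>B. (c b * (complex_of_real (ev b) - complex_of_real l)) *s b) = r *v v - complex_of_real l *s v"
    proof -
      have "r *v v = (\<Sum>b\<in>B. (c b * complex_of_real (ev b)) *s b)"
        unfolding c by (simp add: vec.linear_sum ev vec.scale_sum_right vec.sum vec.scale mult_ac cong: sum.cong)
      then show ?thesis
        by (simp add: c algebra_simps vec.scale_sum_right sum_subtractf vec.scale_left_diff_distrib
            flip: sum_subtractf)
    qed
    then have "(\<Sum>b\<in>B. (c b * (complex_of_real (ev b) - complex_of_real l)) *s b) = 0"
      using v by simp
    then have 0: "c b * (complex_of_real (ev b) - complex_of_real l) = 0" if "b \<in> B" for b
      using vec.independentD[OF B(2) fB subset_refl _ that,
          of "\<lambda>b. c b * (complex_of_real (ev b) - complex_of_real l)"] by simp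
    have "matrix g *v v = g v" by (rule matrix_works[OF g(1)])
    also have "\<dots> = (\<Sum>b\<in>B. c b *s ((complex_of_real (ev b) powr z) *s b))"
    proof -
      interpret g: Vector_Spaces.linear "(*s)" "(*s)" g by (rule g(1))
      show ?thesis unfolding c by (simp add: g.sum g.scale g(2) cong: sum.cong)
    qed
    also have "\<dots> = (\<Sum>b\<in>B. c b *s ((complex_of_real l powr z) *s b))"
      using 0 by (intro sum.cong) auto
    also have "\<dots> = (complex_of_real l powr z) *s v"
      unfolding c by (simp add: vec.scale_sum_right mult_ac)
    finally show ?thesis .
  qed
  then show ?thesis by blast
qed

lemma mat_powr_eigvec:
  assumes "mat_adj r = r" "r *v v = complex_of_real l *s v"
  shows "mat_powr r z *v v = (complex_of_real l powr z) *s v"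
proof -
  obtain x where x: "\<And>l::real. \<And>v. r *v v = complex_of_real l *s v \<Longrightarrow>
    x *v v = (complex_of_real l powr z) *s v"
    using mat_powr_ex[OF assms(1)] by metis
  have "mat_powr r z = x"
    unfolding mat_powr_def
  proof (rule the_equality)
    fix y assume "\<forall>l::real. \<forall>v. r *v v = complex_of_real l *s v \<longrightarrow> y *v v = (complex_of_real l powr z) *s v"
    then show "y = x"
      by (intro mat_eq_on_eigvecs[OF assms(1)]) (metis x)
  qed (use x in blast)
  then show ?thesis using x assms(2) by simp
qed

lemma pos_def_eigenvalue_pos:
  assumes "pos_def r" "r *v v = complex_of_real l *s v" "v \<noteq> 0"
  shows "l > 0"
proof -
  have "0 < Re (csp v (r *v v))"
    using assms by (auto simp: pos_def_def csp_def)
  also have "\<dots> = l * (v \<bullet> v)"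
    unfolding assms(2) csp_scale by (simp add: inner_eq_Re_csp)
  finally show ?thesis
    using inner_ge_zero[of v] by (simp add: zero_less_mult_iff)
qed

lemma mat_powr_add:
  assumes "pos_def r"
  shows "mat_powr r a ** mat_powr r b = mat_powr r (a + b)"
proof -
  have r: "mat_adj r = r" using assms by (simp add: pos_def_def)
  show ?thesis
  proof (rule mat_eq_on_eigvecs[OF r])
    fix l :: real and v assume v: "r *v v = complex_of_real l *s v"
    show "(mat_powr r a ** mat_powr r b) *v v = mat_powr r (a + b) *v v"
      by (simp add: matrix_vector_mul_assoc[symmetric] mat_powr_eigvec[OF r v] powr_add
          vector_scalar_commute mult_ac)
  qed
qed

lemma mat_powr_0:
  assumes "pos_def r"
  shows "mat_powr r 0 = mat 1"
proof -
  have r: "mat_adj r = r" using assms by (simp add: pos_def_def)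
  show ?thesis
  proof (rule mat_eq_on_eigvecs[OF r])
    fix l :: real and v assume v: "r *v v = complex_of_real l *s v"
    \<comment> \<open>Positivity enters because \<open>0 powr 0\<close> is 0: a zero eigenvalue
      would make the power differ from the unit.\<close>
    show "mat_powr r 0 *v v = mat 1 *v v"
      using pos_def_eigenvalue_pos[OF assms v] by (cases "v = 0") (auto simp: mat_powr_eigvec[OF r v])
  qed
qed

text \<open>A matrix commuting with \<open>r\<close> preserves the eigenspaces of \<open>r\<close>,
  and the power is a scalar on each of them.\<close>

lemma mat_powr_commute:
  assumes "mat_adj r = r" "d ** r = r ** d"
  shows "d ** mat_powr r z = mat_powr r z ** d"
proof (rule mat_eq_on_eigvecs[OF assms(1)])
  fix l :: real and v assume v: "r *v v = complex_of_real l *s v"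
  have "r *v (d *v v) = complex_of_real l *s (d *v v)"
    by (metis assms(2) matrix_vector_mul_assoc v vector_scalar_commute)
  from mat_powr_eigvec[OF assms(1) this] mat_powr_eigvec[OF assms(1) v]
  show "(d ** mat_powr r z) *v v = (mat_powr r z ** d) *v v"
    by (simp add: matrix_vector_mul_assoc[symmetric] vector_scalar_commute)
qed

text \<open>Compare both sides as forms on pairs of eigenvectors. For different eigenvalues these
  are orthogonal; for a common one \<open>l powr a\<close> is real, as \<open>l\<close> is positive
  and \<open>a\<close> real.\<close>

lemma mat_adj_mat_powr:
  assumes r: "pos_def r"
  shows "mat_adj (mat_powr r (complex_of_real a)) = mat_powr r (complex_of_real a)"
proof -
  have sa: "mat_adj r = r" using r by (simp add: pos_def_def)
  let ?x = "mat_powr r (complex_of_real a)"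
  show ?thesis
  proof (rule mat_eq_on_eigvecs[OF sa])
    fix l :: real and v assume v: "r *v v = complex_of_real l *s v"
    let ?S = "{w. csp w (mat_adj ?x *v v) = csp w (?x *v v)}"
    have "vec.span (eigvecs r) \<subseteq> ?S"
    proof (rule vec.span_minimal)
      show "eigvecs r \<subseteq> ?S"
      proof
        fix w assume "w \<in> eigvecs r"
        then obtain m :: real where w: "r *v w = complex_of_real m *s w" by (auto simp: eigvecs_def)
        have "csp w (mat_adj ?x *v v) = csp (?x *v w) v"
          using csp_mat_adj[of "mat_adj ?x" w v] by simp
        also have "\<dots> = cnj (complex_of_real m powr complex_of_real a) * csp w v"
          by (simp add: mat_powr_eigvec[OF sa w] csp_scale)
        also have "\<dots> = (complex_of_real l powr complex_of_real a) * csp w v"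
        proof (cases "csp w v = 0")
          case False
          have "complex_of_real m * csp w v = complex_of_real l * csp w v"
            using csp_mat_adj[of r w v] by (simp add: sa v w csp_scale)
          then have [simp]: "m = l" using False by simp
          have "v \<noteq> 0" using False by (auto simp: csp_def)
          then have "l > 0" using pos_def_eigenvalue_pos[OF r v] by simp
          then show ?thesis by (simp add: powr_of_real)
        qed simp
        also have "\<dots> = csp w (?x *v v)"
          by (simp add: mat_powr_eigvec[OF sa v] csp_scale)
        finally show "w \<in> ?S" by simp
      qed
      show "vec.subspace ?S"
        by (auto simp: vec.subspace_def csp_add_left csp_scale) (simp add: csp_def)
    qed
    then show "mat_adj ?x *v v = ?x *v v"
      using vec_span_eigvecs[OF sa] by (intro csp_ext) blast
  qed
qed

section \<open>Block diagonality of powers\<close>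

definition block_unit :: "('i::finite \<Rightarrow> 'a) \<Rightarrow> 'a \<Rightarrow> complex^'i^'i" where
  "block_unit blk a = (\<chi> i j. if j = i then if blk i = a then 1 else 0 else 0)"

text \<open>Recasting block diagonality as commutation with the projections onto the blocks makes
  \<open>mat_powr_commute\<close> applicable to powers.\<close>

lemma block_algebra_iff_commute:
  "x \<in> block_algebra blk \<longleftrightarrow> (\<forall>a. block_unit blk a ** x = x ** block_unit blk a)"
proof -
  have 1: "(block_unit blk a ** x) $ i $ j = (if blk i = a then x $ i $ j else 0)" for a i j
    by (cases "blk i = a")
      (simp_all add: matrix_matrix_mult_def block_unit_def if_distrib[of "\<lambda>z. z * _"] cong: if_cong)
  have 2: "(x ** block_unit blk a) $ i $ j = (if blk j = a then x $ i $ j else 0)" for a i j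
  proof -
    have "(x ** block_unit blk a) $ i $ j = (\<Sum>k\<in>UNIV. if k = j then (if blk j = a then x $ i $ j else 0) else 0)"
      unfolding matrix_matrix_mult_def block_unit_def vec_lambda_beta by (intro sum.cong) auto
    then show ?thesis by simp
  qed
  show ?thesis
    unfolding vec_eq_iff 1 2 block_algebra_def by (auto split: if_splits)
qed

lemma mat_powr_in_block_algebra:
  assumes "mat_adj r = r" "r \<in> block_algebra blk"
  shows "mat_powr r z \<in> block_algebra blk"
  using assms(2) mat_powr_commute[OF assms(1)] unfolding block_algebra_iff_commute by blast

section \<open>Left ideals of matrix algebras\<close>

lemma inner_complex_mult: "(a * b) \<bullet> c = b \<bullet> (cnj a * (c::complex))"
  by (simp add: inner_complex_def algebra_simps)

text \<open>The Euclidean inner product of matrices is the real part of the trace of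
  \<open>mat_adj x ** y\<close>; for it, left multiplication has the expected adjoint.\<close>

lemma inner_mat_mult_left: "(a ** x) \<bullet> y = x \<bullet> (mat_adj a ** (y :: complex^'n::finite^'n))"
proof -
  have "(a ** x) \<bullet> y = (\<Sum>i\<in>UNIV. \<Sum>j\<in>UNIV. \<Sum>k\<in>UNIV. x$k$j \<bullet> (cnj (a$i$k) * y$i$j))"
    by (simp add: inner_vec_def matrix_matrix_mult_def inner_sum_left inner_complex_mult)
  also have "\<dots> = (\<Sum>j\<in>UNIV. \<Sum>i\<in>UNIV. \<Sum>k\<in>UNIV. x$k$j \<bullet> (cnj (a$i$k) * y$i$j))"
    by (rule sum.swap)
  also have "\<dots> = (\<Sum>j\<in>UNIV. \<Sum>k\<in>UNIV. \<Sum>i\<in>UNIV. x$k$j \<bullet> (cnj (a$i$k) * y$i$j))"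
    by (intro sum.cong sum.swap refl)
  also have "\<dots> = (\<Sum>k\<in>UNIV. \<Sum>j\<in>UNIV. \<Sum>i\<in>UNIV. x$k$j \<bullet> (cnj (a$i$k) * y$i$j))"
    by (rule sum.swap)
  also have "\<dots> = x \<bullet> (mat_adj a ** y)"
    by (simp add: inner_vec_def matrix_matrix_mult_def mat_adj_def inner_sum_right)
  finally show ?thesis .
qed

lemma inner_mat_adj: "mat_adj (x :: complex^'n::finite^'n) \<bullet> mat_adj y = x \<bullet> y"
  unfolding inner_vec_def mat_adj_def
  by (subst sum.swap) (simp add: inner_complex_def)

lemma inner_mat_mult_right: "((x :: complex^'n::finite^'n) ** a) \<bullet> y = x \<bullet> (y ** mat_adj a)"
  using inner_mat_mult_left[of "mat_adj a" "mat_adj x" "mat_adj y"]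
  by (simp add: inner_mat_adj flip: mat_adj_mult)
    (metis inner_mat_adj mat_adj_mat_adj mat_adj_mult)

lemma mat_adj_diff: "mat_adj (x - y) = mat_adj x - mat_adj y"
  by (simp add: mat_adj_def vec_eq_iff)

lemma block_algebraD: "x \<in> block_algebra blk \<Longrightarrow> x $ i $ j \<noteq> 0 \<Longrightarrow> blk i = blk j"
  by (auto simp: block_algebra_def)

lemma block_algebra_mult:
  assumes "x \<in> block_algebra blk" "y \<in> block_algebra blk"
  shows "x ** y \<in> block_algebra blk"
proof -
  have "x $ i $ k * y $ k $ j = 0" if "blk i \<noteq> blk j" for i j k
    using assms that by (cases "blk i = blk k") (auto simp: block_algebra_def)
  then show ?thesis
    by (auto simp: block_algebra_def matrix_matrix_mult_def intro!: sum.neutral)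
qed

lemma block_algebra_adj: "x \<in> block_algebra blk \<Longrightarrow> mat_adj x \<in> block_algebra blk"
  by (auto simp: block_algebra_def mat_adj_def)

lemma mat_adj_one: "mat_adj (mat 1) = mat 1"
  by (simp add: mat_adj_def mat_def vec_eq_iff)

lemma block_algebra_one: "mat 1 \<in> block_algebra blk"
  by (auto simp: block_algebra_def mat_def)

lemma block_algebra_zero: "0 \<in> block_algebra blk"
  by (auto simp: block_algebra_def)

lemma block_algebra_diff: "x \<in> block_algebra blk \<Longrightarrow> y \<in> block_algebra blk \<Longrightarrow> x - y \<in> block_algebra blk"
  by (auto simp: block_algebra_def)

lemma block_algebra_add: "x \<in> block_algebra blk \<Longrightarrow> y \<in> block_algebra blk \<Longrightarrow> x + y \<in> block_algebra blk"
  by (auto simp: block_algebra_def)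

lemma mat_mult_diff_left: "(x - y) ** z = x ** z - y ** (z :: complex^'n::finite^'n)"
  by (simp add: matrix_matrix_mult_def vec_eq_iff left_diff_distrib sum_subtractf)

lemma mat_mult_diff_right: "z ** (x - y) = z ** x - z ** (y :: complex^'n::finite^'n)"
  by (simp add: matrix_matrix_mult_def vec_eq_iff right_diff_distrib sum_subtractf)

text \<open>The generator is the orthogonal projection of the unit onto the ideal, for the inner product
  of the trace.\<close>

lemma left_ideal_generated_by_projection:
  fixes L :: "(complex^'n::finite^'n) set"
  assumes L: "subspace L" "L \<subseteq> block_algebra blk"
    and ideal: "\<And>a x. a \<in> block_algebra blk \<Longrightarrow> x \<in> L \<Longrightarrow> a ** x \<in> L"
  obtains p where "p \<in> L" "mat_adj p = p" "p ** p = p" "\<And>x. x \<in> L \<Longrightarrow> x ** p = x"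
proof -
  obtain p z where pz: "p \<in> span L" "\<And>w. w \<in> span L \<Longrightarrow> orthogonal z w" "mat 1 = p + z"
    using orthogonal_subspace_decomp_exists[of L "mat 1"] by blast
  have p: "p \<in> L" using pz(1) L(1) by (metis span_eq_iff)
  have z: "z \<bullet> w = 0" if "w \<in> L" for w
    using pz(2)[of w] that by (simp add: orthogonal_def span_base)
  have zeq: "z = mat 1 - p" using pz(3) by (metis add_diff_cancel_left')
  have right: "x ** p = x" if x: "x \<in> L" for x
  proof -
    \<comment> \<open>The squared length of \<open>x z\<close> is the inner product of
      \<open>z\<close> with \<open>mat_adj x ** (x ** z)\<close>. The latter lies in
      \<open>L\<close>, to which \<open>z\<close> is orthogonal, so \<open>x z = 0\<close>.\<close>
    have eq: "x ** z = x - x ** p" by (simp add: zeq mat_mult_diff_right)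
    have "x ** p \<in> L" using ideal x p L(2) by blast
    then have "x ** z \<in> L" unfolding eq using L(1) x by (intro subspace_diff)
    then have "mat_adj x ** (x ** z) \<in> L"
      using ideal x L(2) block_algebra_adj by blast
    then have "z \<bullet> (mat_adj x ** (x ** z)) = 0" by (rule z)
    then have "(x ** z) \<bullet> (x ** z) = 0" by (simp add: inner_mat_mult_left)
    then show ?thesis using eq by simp
  qed
  have pA: "p \<in> block_algebra blk" using p L(2) by blast
  \<comment> \<open>The same device on the right, with \<open>z ** mat_adj p ** p\<close> in
    \<open>L\<close>, gives \<open>mat_adj p = p ** mat_adj p\<close>. The right side is
    self-adjoint, hence so is \<open>p\<close>.\<close>
  have "z ** mat_adj p \<in> block_algebra blk"
    unfolding zeq by (intro block_algebra_mult block_algebra_diff block_algebra_one block_algebra_adj pA)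
  then have "z \<bullet> ((z ** mat_adj p) ** p) = 0"
    using z ideal p by blast
  then have "(z ** mat_adj p) \<bullet> (z ** mat_adj p) = 0"
    by (simp add: inner_mat_mult_right)
  then have "mat_adj p = p ** mat_adj p"
    by (simp add: zeq mat_mult_diff_left)
  then have "mat_adj p = p"
    by (metis mat_adj_mat_adj mat_adj_mult)
  then show ?thesis
    using that p right by blast
qed

section \<open>Systems of matrix units\<close>

text \<open>The represented matrix units of a direct sum of full matrix algebras. Those joining
  different blocks are set to 0, so that sums may run over all indices; \<open>u_nonzero\<close>
  encodes faithfulness.\<close>

locale matrix_units =
  fixes blk :: "'i::finite \<Rightarrow> 'a" and u :: "'i \<Rightarrow> 'i \<Rightarrow> 'h::complex_hilbert_space \<Rightarrow> 'h"
  assumes u_bounded: "u i j \<in> bounded_ops"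
    and u_off: "blk i \<noteq> blk j \<Longrightarrow> u i j v = 0"
    and u_mult: "u i j (u k l v) = (if j = k \<and> blk i = blk j then u i l v else 0)"
    and u_adj: "cinner (u i j x) y = cinner x (u j i y)"
    and u_one: "(\<Sum>i\<in>UNIV. u i i v) = v"
    and u_nonzero: "\<exists>v. u i i v \<noteq> 0"
begin

lemmas u_simps = bounded_opsD(2-6)[OF u_bounded]

text \<open>The action \<open>(b \<otimes> c) T = b T c\<close>. Row \<open>(i, l)\<close> and
  column \<open>(j, k)\<close> stand for the tensor of the units \<open>i j\<close> and
  \<open>k l\<close>; the reversed second leg makes composition of actions the matrix
  product.\<close>

definition act :: "complex^('i \<times> 'i)^('i \<times> 'i) \<Rightarrow> ('h \<Rightarrow> 'h) \<Rightarrow> 'h \<Rightarrow> 'h" where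
  "act M T v = (\<Sum>a\<in>UNIV. \<Sum>b\<in>UNIV. M $ a $ b *\<^sub>C u (fst a) (fst b) (T (u (snd b) (snd a) v)))"

abbreviation "tensor_algebra \<equiv> block_algebra (map_prod blk blk)"

lemma act_bounded: "T \<in> bounded_ops \<Longrightarrow> act M T \<in> bounded_ops"
  unfolding act_def
  by (intro bounded_ops_sum bounded_ops_scaleC bounded_ops_comp[OF u_bounded]
      bounded_ops_comp[OF _ u_bounded])

lemma act_diff: "act (M - N) T v = act M T v - act N T v"
  by (simp add: act_def scaleC_diff_left sum_subtractf)

lemma act_add: "act (M + N) T v = act M T v + act N T v"
  by (simp add: act_def scaleC_add_left sum.distrib)

lemma act_scaleR: "act (r *\<^sub>R M) T v = r *\<^sub>R act M T v"
  by (simp add: act_def scaleR_scaleC scaleC_sum_right scaleC_scaleC)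
    (simp add: scaleR_conv_of_real)

lemma act_zero_right: "act M (\<lambda>v. 0) = (\<lambda>v. 0)"
  by (rule ext) (simp add: act_def u_simps)

lemma act_zero_left: "act 0 T = (\<lambda>v. 0)"
  by (rule ext) (simp add: act_def)

lemma act_add_right: "act M (\<lambda>v. S v + T v) v = act M S v + act M T v"
  by (simp add: act_def u_simps scaleC_add_right sum.distrib)

lemma act_scaleC_right: "act M (\<lambda>v. c *\<^sub>C T v) v = c *\<^sub>C act M T v"
  by (simp add: act_def u_simps scaleC_sum_right scaleC_scaleC mult.commute)

text \<open>Only products with matching inner indices \<open>c = b\<close> survive.
  \<open>u_mult\<close> asks for equal blocks as well, and membership in
  \<open>tensor_algebra\<close> guarantees these wherever the coefficients are nonzero.\<close>

lemma act_mult: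
  assumes M: "M \<in> tensor_algebra" and N: "N \<in> tensor_algebra" and T: "T \<in> bounded_ops"
  shows "act (M ** N) T = act M (act N T)"
proof
  fix v
  have term_eq: "(M $ a $ b * N $ c $ d) *\<^sub>C
        u (fst a) (fst b) (u (fst c) (fst d) (T (u (snd d) (snd c) (u (snd b) (snd a) v))))
      = (if c = b then (M $ a $ b * N $ b $ d) *\<^sub>C u (fst a) (fst d) (T (u (snd d) (snd a) v)) else 0)"
    for a b c d
  proof (cases "M $ a $ b * N $ c $ d = 0")
    case False
    then have "M $ a $ b \<noteq> 0" "N $ c $ d \<noteq> 0" by auto
    from block_algebraD[OF M this(1)] block_algebraD[OF N this(2)]
    have bl: "blk (fst a) = blk (fst b)" "blk (snd d) = blk (snd c)"
      by (simp_all add: map_prod_def case_prod_beta)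
    consider "c = b" | "c \<noteq> b" "fst c \<noteq> fst b" | "c \<noteq> b" "snd c \<noteq> snd b"
      by (metis prod_eqI)
    then show ?thesis
      by cases (simp_all add: bl u_mult u_simps(3) bounded_opsD(4)[OF T])
  next
    case True
    then have "(M $ a $ b * N $ c $ d) *\<^sub>C x = 0" for x :: 'h
      by (simp only: scaleC_zero_left)
    then show ?thesis by auto
  qed
  have "act M (act N T) v = (\<Sum>a\<in>UNIV. \<Sum>b\<in>UNIV. \<Sum>c\<in>UNIV. \<Sum>d\<in>UNIV.
      (M $ a $ b * N $ c $ d) *\<^sub>C u (fst a) (fst b) (u (fst c) (fst d) (T (u (snd d) (snd c) (u (snd b) (snd a) v)))))"
    by (simp add: act_def u_simps scaleC_sum_right scaleC_scaleC)
  also have "\<dots> = (\<Sum>a\<in>UNIV. \<Sum>b\<in>UNIV. \<Sum>d\<in>UNIV.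
      (M $ a $ b * N $ b $ d) *\<^sub>C u (fst a) (fst d) (T (u (snd d) (snd a) v)))"
    unfolding term_eq
  proof (rule sum.cong[OF refl], rule sum.cong[OF refl])
    fix a b :: "'i \<times> 'i"
    have "(\<Sum>d\<in>UNIV. if c = b then f d else 0) = (if c = b then \<Sum>d\<in>UNIV. f d else 0)"
      for c and f :: "'i \<times> 'i \<Rightarrow> 'h" by simp
    then show "(\<Sum>c\<in>UNIV. \<Sum>d\<in>UNIV. if c = b
          then (M $ a $ b * N $ b $ d) *\<^sub>C u (fst a) (fst d) (T (u (snd d) (snd a) v)) else 0)
        = (\<Sum>d\<in>UNIV. (M $ a $ b * N $ b $ d) *\<^sub>C u (fst a) (fst d) (T (u (snd d) (snd a) v)))"
      by simp
  qed
  also have "\<dots> = (\<Sum>a\<in>UNIV. \<Sum>d\<in>UNIV. \<Sum>b\<in>UNIV.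
      (M $ a $ b * N $ b $ d) *\<^sub>C u (fst a) (fst d) (T (u (snd d) (snd a) v)))"
    by (intro sum.cong sum.swap refl)
  also have "\<dots> = act (M ** N) T v"
    by (simp add: act_def matrix_matrix_mult_def scaleC_sum_left)
  finally show "act (M ** N) T v = act M (act N T) v" by simp
qed

lemma sum_UNIV_prod: "(\<Sum>a\<in>UNIV. f a) = (\<Sum>i\<in>UNIV. \<Sum>j\<in>UNIV. f (i, j))"
  for f :: "'b::finite \<times> 'c::finite \<Rightarrow> 'd::comm_monoid_add"
  by (simp add: sum.cartesian_product flip: UNIV_Times_UNIV)

lemma act_one:
  assumes T: "T \<in> bounded_ops"
  shows "act (mat 1) T = T"
proof
  fix v
  have "act (mat 1) T v = (\<Sum>a\<in>UNIV. u (fst a) (fst a) (T (u (snd a) (snd a) v)))"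
    by (simp add: act_def mat_def if_distrib[of "\<lambda>z. z *\<^sub>C _"] cong: if_cong)
  also have "\<dots> = (\<Sum>i\<in>UNIV. u i i (T (\<Sum>j\<in>UNIV. u j j v)))"
    by (simp add: sum_UNIV_prod u_simps bounded_opsD[OF T] del: u_one)
  also have "\<dots> = T v"
    by (simp add: u_one)
  finally show "act (mat 1) T v = T v" .
qed

text \<open>Each coefficient is read off by letting \<open>M\<close> act on a rank one operator
  between two corners of \<open>H\<close>.\<close>

lemma act_faithful:
  assumes M: "M \<in> tensor_algebra" and 0: "\<And>T. T \<in> bounded_ops \<Longrightarrow> act M T = (\<lambda>v. 0)"
  shows "M = 0"
proof -
  have "M $ a $ b = 0" for a b
  proof (cases "map_prod blk blk a = map_prod blk blk b")
    case True
    obtain x where x: "u (fst b) (fst b) x \<noteq> 0" using u_nonzero by blast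
    obtain y where y: "u (snd b) (snd b) y \<noteq> 0" using u_nonzero by blast
    \<comment> \<open>Cutting with the diagonal units of \<open>b\<close> on both sides makes
      \<open>T\<close> see only column \<open>b\<close>; the outer units in the computation below
      then select row \<open>a\<close>.\<close>
    define T where "T = (\<lambda>v. u (fst b) (fst b) (rank_one x (u (snd b) (snd b) y) (u (snd b) (snd b) v)))"
    have T: "T \<in> bounded_ops"
      unfolding T_def by (rule bounded_ops_comp[OF u_bounded bounded_ops_comp[OF rank_one_bounded u_bounded]])
    have T0: "u i j (T (u k l v)) = (if j = fst b \<and> k = snd b then u i j (T (u k l v)) else 0)" for i j k l v
      by (auto simp: T_def u_mult rank_one_def u_simps)
    have bl: "blk (fst a) = blk (fst b)" "blk (snd a) = blk (snd b)"
      using True by (auto simp: map_prod_def split: prod.splits)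
    have "u (fst b) (fst a) (act M T (u (snd a) (snd b) y)) =
      (\<Sum>c\<in>UNIV. \<Sum>d\<in>UNIV. if c = a then if d = b
        then M $ a $ b *\<^sub>C u (fst b) (fst b) (T (u (snd b) (snd b) y)) else 0 else 0)"
      unfolding act_def u_simps
    proof (intro sum.cong refl)
      fix c d
      show "M $ c $ d *\<^sub>C u (fst b) (fst a) (u (fst c) (fst d) (T (u (snd d) (snd c) (u (snd a) (snd b) y)))) =
        (if c = a then if d = b then M $ a $ b *\<^sub>C u (fst b) (fst b) (T (u (snd b) (snd b) y)) else 0 else 0)"
      proof (cases "c = a \<and> d = b")
        case True
        then show ?thesis using bl by (simp add: u_mult)
      next
        case False
        then consider "fst c \<noteq> fst a" | "snd c \<noteq> snd a" | "fst d \<noteq> fst b \<or> snd d \<noteq> snd b"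
          by (metis prod_eqI)
        then have "u (fst b) (fst a) (u (fst c) (fst d) (T (u (snd d) (snd c) (u (snd a) (snd b) y)))) = 0"
        proof cases
          case 3
          then have "u (fst b) (fst d) (T (u (snd d) (snd b) y)) = 0"
            by (subst T0) auto
          then show ?thesis
            by (simp add: u_mult u_simps(3) bounded_opsD(4)[OF T])
        qed (simp_all add: u_mult u_simps(3) bounded_opsD(4)[OF T])
        then show ?thesis using False by auto
      qed
    qed
    also have "\<dots> = M $ a $ b *\<^sub>C u (fst b) (fst b) (T (u (snd b) (snd b) y))"
    proof -
      have "(\<Sum>d\<in>UNIV. if c = a then if d = b then x else 0 else 0) = (if c = a then x else 0)"
        for c and x :: 'h by simp
      then show ?thesis by simp
    qed
    also have "u (fst b) (fst b) (T (u (snd b) (snd b) y)) =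
        cinner (u (snd b) (snd b) y) (u (snd b) (snd b) y) *\<^sub>C u (fst b) (fst b) x"
      by (simp add: T_def u_mult rank_one_def u_simps)
    finally have eq: "(M $ a $ b * cinner (u (snd b) (snd b) y) (u (snd b) (snd b) y)) *\<^sub>C u (fst b) (fst b) x = 0"
      using 0[OF T] by (simp add: u_simps scaleC_scaleC)
    then have "norm ((M $ a $ b * cinner (u (snd b) (snd b) y) (u (snd b) (snd b) y)) *\<^sub>C u (fst b) (fst b) x) = 0"
      by simp
    then show ?thesis using x y by (simp add: norm_scaleC)
  next
    case False
    then show ?thesis using block_algebraD[OF M] by blast
  qed
  then show ?thesis by (simp add: vec_eq_iff)
qed

text \<open>The adjoint of \<open>b T c\<close> reverses the three factors: the legs change places
  and each is replaced by its adjoint. In coordinates, coefficients are conjugated and both indices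
  swapped.\<close>

lemma op_adj_act:
  assumes T: "T \<in> bounded_ops"
  shows "op_adj (act M T) = act (\<chi> a b. cnj (M $ prod.swap a $ prod.swap b)) (op_adj T)"
proof (rule op_adj_eqI)
  let ?M = "\<chi> a b. cnj (M $ prod.swap a $ prod.swap b)"
  show "act ?M (op_adj T) \<in> bounded_ops"
    by (intro act_bounded op_adj_bounded T)
  have swap: "(\<Sum>a\<in>UNIV. f (prod.swap a)) = (\<Sum>a\<in>UNIV. f a)" for f :: "'i \<times> 'i \<Rightarrow> complex"
    by (rule sum.reindex_bij_betw) (simp add: bij_swap)
  fix x y
  define g where "g a b = M $ a $ b * cinner x (u (fst a) (fst b) (T (u (snd b) (snd a) y)))" for a b
  have "cinner (act ?M (op_adj T) x) y = (\<Sum>a\<in>UNIV. \<Sum>b\<in>UNIV. g (prod.swap a) (prod.swap b))"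
    by (simp add: act_def cinner_sum_left cinner_scaleC_left u_adj cinner_op_adj_left[OF T] g_def)
  also have "\<dots> = (\<Sum>a\<in>UNIV. \<Sum>b\<in>UNIV. g (prod.swap a) b)"
    by (intro sum.cong refl swap)
  also have "\<dots> = (\<Sum>a\<in>UNIV. \<Sum>b\<in>UNIV. g a b)"
    by (rule swap)
  also have "\<dots> = cinner x (act M T y)"
    by (simp add: act_def cinner_sum_right cinner_scaleC_right g_def)
  finally show "cinner (act ?M (op_adj T) x) y = cinner x (act M T y)" .
qed

end

section \<open>Weak* closed bimodules\<close>

lemma topspace_weak_star:
  "topspace (weak_star_topology :: ('h::complex_hilbert_space \<Rightarrow> 'h) topology) = bounded_ops"
proof -
  \<comment> \<open>Some normal functional is needed so that, with \<open>U = UNIV\<close>, all of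
    \<open>bounded_ops\<close> is a subbasic set.\<close>
  have "(\<lambda>T. \<Sum>n. cinner 0 (T 0)) \<in> (normal_functionals :: (('h \<Rightarrow> 'h) \<Rightarrow> complex) set)"
    unfolding normal_functionals_def
    by (rule CollectI, rule exI[of _ "\<lambda>n. 0"], rule exI[of _ "\<lambda>n. 0"]) simp
  then show ?thesis
    unfolding weak_star_topology_def topology_generated_by_topspace
    by (auto intro!: exI[of _ "bounded_ops :: ('h \<Rightarrow> 'h) set"] exI[of _ UNIV])
qed

lemma vector_functional_normal:
  "(\<lambda>T::'h::complex_hilbert_space \<Rightarrow> 'h. cinner x (T y)) \<in> normal_functionals"
proof -
  let ?f = "\<lambda>z n. if n = (0::nat) then z else (0::'h)"
  have eq: "(\<lambda>T. cinner x (T y)) = (\<lambda>T. \<Sum>n. cinner (?f x n) (T (?f y n)))"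
  proof
    fix T :: "'h \<Rightarrow> 'h"
    have "(\<Sum>n. cinner (?f x n) (T (?f y n))) = (\<Sum>n\<in>{0}. cinner (?f x n) (T (?f y n)))"
      by (rule suminf_finite) auto
    then show "cinner x (T y) = (\<Sum>n. cinner (?f x n) (T (?f y n)))" by simp
  qed
  have summ: "summable (\<lambda>n. (norm (?f z n))\<^sup>2)" for z
    by (rule summable_finite[of "{0}"]) auto
  show ?thesis
    unfolding normal_functionals_def eq
    by (rule CollectI, rule exI[of _ "?f x"], rule exI[of _ "?f y"]) (intro conjI refl summ)
qed

lemma continuous_map_normal_functional:
  assumes "\<omega> \<in> normal_functionals"
  shows "continuous_map weak_star_topology euclidean \<omega>"
  unfolding continuous_map_def topspace_weak_star
proof (intro conjI allI impI)
  fix U :: "complex set" assume "openin euclidean U"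
  then have "open U" by simp
  then show "openin weak_star_topology {T \<in> bounded_ops. \<omega> T \<in> U}"
    unfolding weak_star_topology_def
    by (intro topology_generated_by_Basis CollectI exI[of _ \<omega>] exI[of _ U] conjI refl assms)
qed simp

text \<open>A basic neighbourhood tests finitely many functionals. Sequences therefore suffice,
  provided they may depend on the finite set of functionals considered.\<close>

lemma weak_star_closed_limit:
  assumes V: "closedin weak_star_topology V" and T0: "T0 \<in> bounded_ops"
    and approx: "\<And>\<Omega>. finite \<Omega> \<Longrightarrow> \<Omega> \<subseteq> normal_functionals \<Longrightarrow>
      \<exists>X::nat \<Rightarrow> _. (\<forall>n. X n \<in> V) \<and> (\<forall>\<omega>\<in>\<Omega>. (\<lambda>n. \<omega> (X n)) \<longlonglongrightarrow> \<omega> T0)"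
  shows "T0 \<in> V"
proof (rule ccontr)
  assume "T0 \<notin> V"
  have sub: "V \<subseteq> bounded_ops"
    using closedin_subset[OF V] by (simp add: topspace_weak_star)
  let ?S = "{{T \<in> bounded_ops. \<omega> T \<in> U} | \<omega> U. \<omega> \<in> normal_functionals \<and> open U}"
  \<comment> \<open>Induction over the generation of open sets: an intersection takes the union of
    both sets of functionals, a union needs only one member containing \<open>T0\<close>.\<close>
  have nbhd: "\<exists>\<Omega>. finite \<Omega> \<and> \<Omega> \<subseteq> normal_functionals \<and> (\<forall>X::nat \<Rightarrow> _.
      (\<forall>n. X n \<in> bounded_ops) \<longrightarrow> (\<forall>\<omega>\<in>\<Omega>. (\<lambda>n. \<omega> (X n)) \<longlonglongrightarrow> \<omega> T0) \<longrightarrow> (\<forall>\<^sub>F n in sequentially. X n \<in> W))"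
    if "generate_topology_on ?S W" "T0 \<in> W" for W
    using that
  proof (induction W rule: generate_topology_on.induct)
    case (Int a b)
    then obtain \<Omega> \<Omega>' where
      "finite \<Omega>" "\<Omega> \<subseteq> normal_functionals" "\<forall>X::nat \<Rightarrow> _.
        (\<forall>n. X n \<in> bounded_ops) \<longrightarrow> (\<forall>\<omega>\<in>\<Omega>. (\<lambda>n. \<omega> (X n)) \<longlonglongrightarrow> \<omega> T0) \<longrightarrow> (\<forall>\<^sub>F n in sequentially. X n \<in> a)"
      "finite \<Omega>'" "\<Omega>' \<subseteq> normal_functionals" "\<forall>X::nat \<Rightarrow> _.
        (\<forall>n. X n \<in> bounded_ops) \<longrightarrow> (\<forall>\<omega>\<in>\<Omega>'. (\<lambda>n. \<omega> (X n)) \<longlonglongrightarrow> \<omega> T0) \<longrightarrow> (\<forall>\<^sub>F n in sequentially. X n \<in> b)"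
      by auto
    then show ?case
      by (intro exI[of _ "\<Omega> \<union> \<Omega>'"]) (auto simp: eventually_conj_iff)
  next
    case (UN K)
    then obtain k where "k \<in> K" "T0 \<in> k" by blast
    with UN.IH[OF this] obtain \<Omega> where \<Omega>: "finite \<Omega>" "\<Omega> \<subseteq> normal_functionals" "\<forall>X::nat \<Rightarrow> _.
        (\<forall>n. X n \<in> bounded_ops) \<longrightarrow> (\<forall>\<omega>\<in>\<Omega>. (\<lambda>n. \<omega> (X n)) \<longlonglongrightarrow> \<omega> T0) \<longrightarrow> (\<forall>\<^sub>F n in sequentially. X n \<in> k)"
      by blast
    have "\<forall>\<^sub>F n in sequentially. X n \<in> \<Union>K" if "\<forall>\<^sub>F n in sequentially. X n \<in> k" for X :: "nat \<Rightarrow> _"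
      using that by (rule eventually_mono) (use \<open>k \<in> K\<close> in blast)
    with \<Omega> show ?case by (intro exI[of _ \<Omega>]) blast
  next
    case (Basis s)
    then obtain \<omega> U where s: "s = {T \<in> bounded_ops. \<omega> T \<in> U}" "\<omega> \<in> normal_functionals" "open U" by blast
    then have "\<omega> T0 \<in> U" using Basis by blast
    have "\<forall>\<^sub>F n in sequentially. X n \<in> s"
      if X: "\<forall>n. X n \<in> bounded_ops" "(\<lambda>n. \<omega> (X n)) \<longlonglongrightarrow> \<omega> T0" for X :: "nat \<Rightarrow> _"
      using topological_tendstoD[OF X(2) s(3) \<open>\<omega> T0 \<in> U\<close>] X(1) by (simp add: s(1))
    then show ?case by (intro exI[of _ "{\<omega>}"]) (use s(2) in auto)
  qed auto
  have "openin weak_star_topology (topspace weak_star_topology - V)"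
    using V by (simp add: closedin_def)
  then have "generate_topology_on ?S (topspace weak_star_topology - V)"
    unfolding weak_star_topology_def openin_topology_generated_by_iff .
  from nbhd[OF this] T0 \<open>T0 \<notin> V\<close> obtain \<Omega> where \<Omega>: "finite \<Omega>" "\<Omega> \<subseteq> normal_functionals"
    "\<forall>X::nat \<Rightarrow> _. (\<forall>n. X n \<in> bounded_ops) \<longrightarrow> (\<forall>\<omega>\<in>\<Omega>. (\<lambda>n. \<omega> (X n)) \<longlonglongrightarrow> \<omega> T0) \<longrightarrow>
      (\<forall>\<^sub>F n in sequentially. X n \<in> topspace weak_star_topology - V)"
    by (auto simp: topspace_weak_star)
  from approx[OF \<Omega>(1,2)] obtain X :: "nat \<Rightarrow> _" where
    X: "\<And>n. X n \<in> V" "\<forall>\<omega>\<in>\<Omega>. (\<lambda>n. \<omega> (X n)) \<longlonglongrightarrow> \<omega> T0" by blast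
  have "\<forall>\<^sub>F n in sequentially. X n \<in> topspace weak_star_topology - V"
    using \<Omega>(3) X sub by blast
  then have "\<forall>\<^sub>F n in sequentially. False"
    by (rule eventually_mono) (use X in blast)
  then show False by simp
qed

lemma op_subspaceD:
  assumes "op_subspace V"
  shows "V \<subseteq> bounded_ops" "(\<lambda>v. 0) \<in> V" "S \<in> V \<Longrightarrow> T \<in> V \<Longrightarrow> (\<lambda>v. S v + T v) \<in> V"
    "T \<in> V \<Longrightarrow> (\<lambda>v. c *\<^sub>C T v) \<in> V"
  using assms by (auto simp: op_subspace_def)

lemma op_subspace_sum:
  assumes "op_subspace V" "\<And>i. i \<in> I \<Longrightarrow> f i \<in> V"
  shows "(\<lambda>v. \<Sum>i\<in>I. f i v) \<in> V"
  using assms(2)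
  by (induction I rule: infinite_finite_induct) (auto intro: op_subspaceD[OF assms(1)])

section \<open>Amplified finite rank operators in the commutant\<close>

context matrix_units
begin

definition u_commutant :: "('h \<Rightarrow> 'h) set" where
  "u_commutant = {T \<in> bounded_ops. \<forall>i j v. T (u i j v) = u i j (T v)}"

text \<open>The block of \<open>r\<close> splits \<open>H\<close> into a matrix factor tensored with
  the corner \<open>u r r H\<close>. This is the identity of the former tensored with the rank one
  operator of \<open>u r r x\<close> and \<open>u r r y\<close>, and 0 on other blocks.\<close>

definition ampliation :: "'i \<Rightarrow> 'h \<Rightarrow> 'h \<Rightarrow> 'h \<Rightarrow> 'h" where
  "ampliation r x y v = (\<Sum>i\<in>UNIV. u i r (rank_one x y (u r i v)))"

lemma ampliation_commutant: "ampliation r x y \<in> u_commutant"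
  unfolding u_commutant_def
proof (intro CollectI conjI allI)
  show "ampliation r x y \<in> bounded_ops"
    unfolding ampliation_def
    by (intro bounded_ops_sum bounded_ops_comp[OF u_bounded bounded_ops_comp[OF rank_one_bounded u_bounded]])
  fix k l v
  note R0 = bounded_opsD(4)[OF rank_one_bounded[of x y]]
  have "ampliation r x y (u k l v) =
      (\<Sum>i\<in>UNIV. if i = k then if blk r = blk k then u k r (rank_one x y (u r l v)) else 0 else 0)"
    unfolding ampliation_def by (intro sum.cong refl) (simp add: u_mult R0 u_simps(3))
  also have "\<dots> = (if blk r = blk k then u k r (rank_one x y (u r l v)) else 0)"
    by simp
  \<comment> \<open>The conditions may be exchanged because the operator expression vanishes unless
    \<open>k\<close>, \<open>r\<close> and \<open>l\<close> lie in one block.\<close>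
  also have "\<dots> = (if blk k = blk l then u k r (rank_one x y (u r l v)) else 0)"
    using u_off[of k r] u_off[of r l] by (auto simp: R0 u_simps(3))
  also have "\<dots> = (\<Sum>i\<in>UNIV. if i = l then if blk k = blk l then u k r (rank_one x y (u r l v)) else 0 else 0)"
    by simp
  also have "\<dots> = u k l (ampliation r x y v)"
    unfolding ampliation_def u_simps by (intro sum.cong refl) (simp add: u_mult)
  finally show "ampliation r x y (u k l v) = u k l (ampliation r x y v)" .
qed

text \<open>The squared norm of \<open>u i j v\<close> is \<open><v, u j j v>\<close> or 0;
  Cauchy-Schwarz settles the diagonal case first and then the general one.\<close>

lemma u_contraction: "norm (u i j v) \<le> norm v"
proof -
  have sq: "(norm (u i j v))\<^sup>2 = cmod (cinner v (u j i (u i j v)))" for i j v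
    unfolding u_adj[symmetric] cinner_norm by (simp only: norm_of_real abs_of_nonneg zero_le_power2)
  have diag: "norm (u j j v) \<le> norm v" for j
  proof -
    have "(norm (u j j v))\<^sup>2 \<le> norm v * norm (u j j v)"
      unfolding sq using cinner_Cauchy_Schwarz[of v "u j j v"] by (simp add: u_mult)
    then show ?thesis
      by (cases "norm (u j j v) = 0") (auto simp: power2_eq_square mult_le_cancel_right)
  qed
  have "(norm (u i j v))\<^sup>2 \<le> norm v * norm v"
    unfolding sq
    using cinner_Cauchy_Schwarz[of v "u j j v"] mult_left_mono[OF diag[of j] norm_ge_zero[of v]]
    by (auto simp: u_mult)
  then show ?thesis
    by (metis norm_ge_zero power2_eq_square power2_le_imp_le)
qed

definition block_size :: "'i \<Rightarrow> nat" where
  "block_size j = card {i. blk i = blk j}"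

text \<open>For orthonormal \<open>U\<close> this is the projection onto the span of
  \<open>U\<close>, averaged into the commutant by the conditional expectation that sends
  \<open>x\<close> to the sum of \<open>u i j x u j i\<close> over the block size.\<close>

definition approx_unit :: "'h set \<Rightarrow> 'h \<Rightarrow> 'h" where
  "approx_unit U v = (\<Sum>j\<in>UNIV. \<Sum>w\<in>U. (1 / of_nat (block_size j)) *\<^sub>C ampliation j w w v)"

lemma block_size_pos: "block_size j > 0"
  unfolding block_size_def by (auto simp: card_gt_0_iff)

lemma approx_unit_eq:
  "approx_unit U v = (\<Sum>j\<in>UNIV. \<Sum>i\<in>UNIV. (1 / of_nat (block_size j)) *\<^sub>C u i j (\<Sum>w\<in>U. rank_one w w (u j i v)))"
  unfolding approx_unit_def
proof (rule sum.cong[OF refl])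
  fix j
  show "(\<Sum>w\<in>U. (1 / of_nat (block_size j)) *\<^sub>C ampliation j w w v) =
    (\<Sum>i\<in>UNIV. (1 / of_nat (block_size j)) *\<^sub>C u i j (\<Sum>w\<in>U. rank_one w w (u j i v)))"
    unfolding ampliation_def u_simps scaleC_sum_right by (rule sum.swap)
qed

lemma cinner_ampliation: "cinner (ampliation r x y v) w = cinner v (ampliation r y x w)"
  by (simp add: ampliation_def cinner_sum_left cinner_sum_right u_adj cinner_rank_one_left)

lemma cinner_approx_unit: "cinner (approx_unit U x) y = cinner x (approx_unit U y)"
  by (simp add: approx_unit_def cinner_sum_left cinner_sum_right cinner_scaleC_left
      cinner_scaleC_right cinner_ampliation)

text \<open>A crude count: every summand is a contraction by \<open>bessel\<close> and
  \<open>u_contraction\<close>. Only the independence of the bound from \<open>U\<close> is used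
  later.\<close>

lemma approx_unit_norm:
  assumes "finite U" "\<And>u v. u \<in> U \<Longrightarrow> v \<in> U \<Longrightarrow> cinner u v = (if u = v then 1 else 0)"
  shows "norm (approx_unit U v) \<le> (real CARD('i))\<^sup>2 * norm v"
proof -
  have term_le: "norm ((1 / of_nat (block_size j)) *\<^sub>C u i j (\<Sum>w\<in>U. rank_one w w (u j i v))) \<le> norm v" for i j
  proof -
    have "norm (u i j (\<Sum>w\<in>U. rank_one w w (u j i v))) \<le> norm v"
      using u_contraction[of i j "\<Sum>w\<in>U. rank_one w w (u j i v)"] bessel[OF assms, of "u j i v"]
        u_contraction[of j i v] by linarith
    moreover have "1 / real (block_size j) \<le> 1" using block_size_pos[of j] by simp
    ultimately have "1 / real (block_size j) * norm (u i j (\<Sum>w\<in>U. rank_one w w (u j i v))) \<le> 1 * norm v"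
      by (intro mult_mono) auto
    then show ?thesis by (simp add: norm_scaleC norm_divide)
  qed
  have "norm (approx_unit U v) \<le> (\<Sum>j\<in>(UNIV::'i set). \<Sum>i\<in>(UNIV::'i set). norm v)"
    unfolding approx_unit_eq by (intro sum_norm_le term_le)
  then show ?thesis by (simp add: power2_eq_square)
qed

text \<open>For fixed \<open>i\<close>, each of the \<open>block_size i\<close> indices
  \<open>j\<close> in its block contributes the same vector \<open>u i i a\<close>; the weights
  cancel that multiplicity.\<close>

lemma approx_unit_fixes:
  assumes "\<And>i j. (\<Sum>w\<in>U. rank_one w w (u j i a)) = u j i a"
  shows "approx_unit U a = a"
proof -
  have "approx_unit U a = (\<Sum>j\<in>UNIV. \<Sum>i\<in>UNIV. (1 / of_nat (block_size j)) *\<^sub>C (if blk i = blk j then u i i a else 0))"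
    unfolding approx_unit_eq assms by (simp add: u_mult)
  also have "\<dots> = (\<Sum>i\<in>UNIV. \<Sum>j\<in>UNIV. (1 / of_nat (block_size j)) *\<^sub>C (if blk i = blk j then u i i a else 0))"
    by (rule sum.swap)
  also have "\<dots> = (\<Sum>i\<in>UNIV. u i i a)"
  proof (rule sum.cong[OF refl])
    fix i
    have "(\<Sum>j\<in>UNIV. (1 / of_nat (block_size j)) *\<^sub>C (if blk i = blk j then u i i a else 0)) =
      (\<Sum>j\<in>UNIV. (if blk j = blk i then 1 / of_nat (block_size i) else 0) *\<^sub>C u i i a)"
      by (intro sum.cong refl) (auto simp: block_size_def)
    also have "\<dots> = (\<Sum>j\<in>UNIV. if blk j = blk i then 1 / of_nat (block_size i) else 0) *\<^sub>C u i i a"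
      by (rule scaleC_sum_left[symmetric])
    also have "(\<Sum>j\<in>UNIV. if blk j = blk i then 1 / of_nat (block_size i) else 0) = (1 :: complex)"
      using block_size_pos[of i]
      by (simp add: sum.If_cases) (simp add: block_size_def)
    finally show "(\<Sum>j\<in>UNIV. (1 / of_nat (block_size j)) *\<^sub>C (if blk i = blk j then u i i a else 0)) = u i i a"
      by simp
  qed
  also have "\<dots> = a" by (rule u_one)
  finally show ?thesis .
qed

end

section \<open>Duality between bimodules and annihilators\<close>

context matrix_units
begin

lemma ampliation_bounded: "ampliation r x y \<in> bounded_ops"
  using ampliation_commutant by (auto simp: u_commutant_def)

definition coef :: "'i \<Rightarrow> 'i \<Rightarrow> 'h \<Rightarrow> 'h \<Rightarrow> ('h \<Rightarrow> 'h) \<Rightarrow> complex^('i \<times> 'i)" where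
  "coef r s x y T = (\<chi> b. cinner x (u r (fst b) (T (u (snd b) s y))))"

definition elem_op :: "'i \<Rightarrow> 'i \<Rightarrow> complex^('i \<times> 'i) \<Rightarrow> 'h \<Rightarrow> 'h \<Rightarrow> 'h \<Rightarrow> 'h" where
  "elem_op r s X x y v = (\<Sum>b\<in>UNIV. X $ b *\<^sub>C u (fst b) r (rank_one x y (u s (snd b) v)))"

lemma elem_op_add: "elem_op r s (X + Y) x y = (\<lambda>v. elem_op r s X x y v + elem_op r s Y x y v)"
  by (rule ext) (simp add: elem_op_def scaleC_add_left sum.distrib)

lemma elem_op_scale: "elem_op r s (c *s X) x y = (\<lambda>v. c *\<^sub>C elem_op r s X x y v)"
  by (rule ext) (simp add: elem_op_def scaleC_sum_right scaleC_scaleC)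

lemma elem_op_zero: "elem_op r s 0 x y = (\<lambda>v. 0)"
  by (rule ext) (simp add: elem_op_def)

text \<open>Multiplying out the rank one factors leaves scalars: the compression depends on
  \<open>T\<close> only through the finite vector \<open>coef\<close>, which moves the question of
  membership in \<open>V\<close> to finite dimension.\<close>

lemma ampliation_sandwich:
  assumes T: "T \<in> bounded_ops"
  shows "ampliation r x x' \<circ> T \<circ> ampliation s y' y = elem_op r s (coef r s x' y' T) x y"
proof
  fix v
  have "u i r (rank_one x x' (u r i (T (u k s (rank_one y' y (u s k v)))))) =
      cinner x' (u r i (T (u k s y'))) *\<^sub>C u i r (rank_one x y (u s k v))" for i k
    by (simp add: rank_one_def u_simps(1) bounded_opsD(2)[OF T] cinner_scaleC_right scaleC_scaleC
        mult.commute)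
  then show "(ampliation r x x' \<circ> T \<circ> ampliation s y' y) v = elem_op r s (coef r s x' y' T) x y v"
    by (simp add: ampliation_def elem_op_def coef_def sum_UNIV_prod bounded_opsD(6)[OF T] u_simps(5)
        bounded_opsD(6)[OF rank_one_bounded])
qed

text \<open>If the coefficient vector were not in \<open>S\<close>, a vector separating it from \<open>S\<close> would give an
  element of the annihilator of \<open>V\<close> that does not annihilate \<open>T\<^sub>0\<close>.\<close>

lemma ampliation_sandwich_mem:
  assumes V: "op_bimodule u_commutant V" and T0: "T0 \<in> bounded_ops"
    and ann: "\<And>Q. Q \<in> tensor_algebra \<Longrightarrow> (\<And>T. T \<in> V \<Longrightarrow> act Q T = (\<lambda>v. 0)) \<Longrightarrow> act Q T0 = (\<lambda>v. 0)"
  shows "ampliation r x x' \<circ> T0 \<circ> ampliation s y' y \<in> V"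
proof -
  have sub: "op_subspace V" using V by (simp add: op_bimodule_def)
  note subD = op_subspaceD[OF sub]
  \<comment> \<open>Asking for all \<open>x\<close> and \<open>y\<close> makes \<open>S\<close>
    depend on \<open>V\<close>, \<open>r\<close> and \<open>s\<close> only, so that every
    coefficient vector of every element of \<open>V\<close> lies in it.\<close>
  define S where "S = {X. \<forall>x y. elem_op r s X x y \<in> V}"
  have S_scale: "c *s X \<in> S" if "X \<in> S" for c X
    using that subD(4) by (simp add: S_def elem_op_scale)
  have S_sub: "subspace S"
    unfolding subspace_def
  proof (intro conjI ballI allI)
    show "0 \<in> S" using subD(2) by (simp add: S_def elem_op_zero)
    show "X + Y \<in> S" if "X \<in> S" "Y \<in> S" for X Y
      using that subD(3) by (simp add: S_def elem_op_add)
    show "c *\<^sub>R X \<in> S" if "X \<in> S" for c X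
      using S_scale[OF that] by (simp add: scaleR_vec_complex)
  qed
  have coef_S: "coef r s \<xi> \<eta> T \<in> S" if "T \<in> V" for \<xi> \<eta> T
  proof -
    have "elem_op r s (coef r s \<xi> \<eta> T) x y \<in> V" for x y
    proof -
      have "ampliation r x \<xi> \<circ> T \<circ> ampliation s \<eta> y \<in> V"
        using V that ampliation_commutant by (auto simp: op_bimodule_def)
      moreover have "T \<in> bounded_ops" using that subD(1) by blast
      ultimately show ?thesis by (simp only: ampliation_sandwich)
    qed
    then show ?thesis by (simp add: S_def)
  qed
  define X0 where "X0 = coef r s x' y' T0"
  obtain p z where pz: "p \<in> span S" "\<And>w. w \<in> span S \<Longrightarrow> orthogonal z w" "X0 = p + z"
    using orthogonal_subspace_decomp_exists[of S X0] by blast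
  have zS: "z \<bullet> X = 0" if "X \<in> S" for X
    using pz(2)[of X] that by (simp add: orthogonal_def span_base)
  \<comment> \<open>The decomposition above is orthogonal for the real inner product; since
    \<open>S\<close> is closed under multiplication by \<open>i\<close>, the Hermitian product
    vanishes too.\<close>
  have csp_zS: "csp z X = 0" if "X \<in> S" for X
  proof -
    have "Re (csp z X) = 0" using zS[OF that] by (simp add: inner_eq_Re_csp)
    moreover have "Re (csp z (\<i> *s X)) = 0"
      using zS[OF S_scale[OF that]] by (simp add: inner_eq_Re_csp)
    ultimately show ?thesis by (simp add: csp_scale complex_eq_iff)
  qed
  \<comment> \<open>A single row holding the conjugate of \<open>z\<close>, so that matrix
    coefficients of \<open>act Q T\<close> are products of \<open>z\<close> with
    \<open>coef\<close>. Entries outside the blocks of \<open>r\<close> and \<open>s\<close> are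
    dropped; they would meet zero units.\<close>
  define Q :: "complex^('i \<times> 'i)^('i \<times> 'i)" where
    "Q = (\<chi> a b. if a = (r, s) then if blk (fst b) = blk r \<and> blk (snd b) = blk s then cnj (z $ b) else 0 else 0)"
  have Q: "Q \<in> tensor_algebra"
    by (auto simp: Q_def block_algebra_def)
  have act_Q: "cinner \<xi> (act Q T \<eta>) = csp z (coef r s \<xi> \<eta> T)" if T: "T \<in> bounded_ops" for T \<xi> \<eta>
  proof -
    have "act Q T \<eta> = (\<Sum>a\<in>UNIV. if a = (r, s) then \<Sum>b\<in>UNIV. Q $ (r, s) $ b *\<^sub>C u r (fst b) (T (u (snd b) s \<eta>)) else 0)"
      unfolding act_def by (intro sum.cong refl) (simp add: Q_def)
    also have "\<dots> = (\<Sum>b\<in>UNIV. cnj (z $ b) *\<^sub>C u r (fst b) (T (u (snd b) s \<eta>)))"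
    proof -
      have "Q $ (r, s) $ b *\<^sub>C u r (fst b) (T (u (snd b) s \<eta>)) = cnj (z $ b) *\<^sub>C u r (fst b) (T (u (snd b) s \<eta>))" for b
        using u_off[of r "fst b"] u_off[of "snd b" s]
        by (auto simp: Q_def bounded_opsD(4)[OF T] u_simps(3))
      then show ?thesis by simp
    qed
    finally show ?thesis
      by (simp add: csp_def coef_def cinner_sum_right cinner_scaleC_right)
  qed
  have "act Q T = (\<lambda>v. 0)" if "T \<in> V" for T
  proof
    fix v
    have "T \<in> bounded_ops" using that subD(1) by blast
    then show "act Q T v = 0"
      by (intro cinner_ext_right) (simp add: act_Q csp_zS coef_S that)
  qed
  then have "act Q T0 = (\<lambda>v. 0)" by (rule ann[OF Q])
  then have "csp z X0 = 0"
    unfolding X0_def act_Q[OF T0, symmetric] by simp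
  then have "z \<bullet> X0 = 0" by (simp add: inner_eq_Re_csp)
  moreover have "z \<bullet> X0 = z \<bullet> z"
    using pz(2)[OF pz(1)] by (simp add: pz(3) inner_add_right orthogonal_def)
  ultimately have "z = 0" by simp
  then have "X0 \<in> S"
    using pz(1,3) S_sub by (metis add.right_neutral span_eq_iff)
  then show ?thesis
    unfolding ampliation_sandwich[OF T0] X0_def[symmetric] by (simp add: S_def)
qed

lemma approx_unit_sandwich_mem:
  assumes V: "op_subspace V" and T0: "T0 \<in> bounded_ops"
    and mem: "\<And>r s x y. ampliation r x x \<circ> T0 \<circ> ampliation s y y \<in> V"
  shows "approx_unit U \<circ> T0 \<circ> approx_unit U \<in> V"
proof -
  define c where "c j = 1 / (of_nat (block_size j) :: complex)" for j
  have "approx_unit U \<circ> T0 \<circ> approx_unit U = (\<lambda>v. \<Sum>j\<in>UNIV. \<Sum>w\<in>U. c j *\<^sub>C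
      (\<Sum>k\<in>UNIV. \<Sum>w'\<in>U. c k *\<^sub>C (ampliation j w w \<circ> T0 \<circ> ampliation k w' w') v))"
    by (rule ext) (simp add: approx_unit_def c_def[symmetric] bounded_opsD(2,6)[OF T0]
        bounded_opsD(2,6)[OF ampliation_bounded])
  also have "\<dots> \<in> V"
    by (intro op_subspace_sum[OF V] op_subspaceD(4)[OF V] mem)
  finally show ?thesis .
qed

text \<open>For the given functionals choose approximate units \<open>F\<close> from the commutant
  and approximate \<open>T0\<close> by the operators \<open>F T0 F\<close>, which lie in
  \<open>V\<close>.\<close>

lemma bimodule_annihilator:
  assumes V: "op_bimodule u_commutant V" and closed: "closedin weak_star_topology V"
    and T0: "T0 \<in> bounded_ops"
    and ann: "\<And>Q. Q \<in> tensor_algebra \<Longrightarrow> (\<And>T. T \<in> V \<Longrightarrow> act Q T = (\<lambda>v. 0)) \<Longrightarrow> act Q T0 = (\<lambda>v. 0)"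
  shows "T0 \<in> V"
proof (rule weak_star_closed_limit[OF closed T0])
  fix \<Omega> :: "(('h \<Rightarrow> 'h) \<Rightarrow> complex) set"
  assume \<Omega>: "finite \<Omega>" "\<Omega> \<subseteq> normal_functionals"
  have sub: "op_subspace V" using V by (simp add: op_bimodule_def)
  have "\<forall>\<omega>\<in>\<Omega>. \<exists>\<xi> \<eta>. \<omega> = (\<lambda>T. \<Sum>n. cinner (\<xi> n) (T (\<eta> n))) \<and>
      summable (\<lambda>n. (norm (\<xi> n))\<^sup>2) \<and> summable (\<lambda>n. (norm (\<eta> n))\<^sup>2)"
    using \<Omega>(2) unfolding normal_functionals_def by blast
  from bchoice[OF this] obtain \<xi> where "\<forall>\<omega>\<in>\<Omega>. \<exists>\<eta>. \<omega> = (\<lambda>T. \<Sum>n. cinner (\<xi> \<omega> n) (T (\<eta> n))) \<and>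
      summable (\<lambda>n. (norm (\<xi> \<omega> n))\<^sup>2) \<and> summable (\<lambda>n. (norm (\<eta> n))\<^sup>2)" ..
  from bchoice[OF this] obtain \<eta> where \<eta>: "\<forall>\<omega>\<in>\<Omega>. \<omega> = (\<lambda>T. \<Sum>n. cinner (\<xi> \<omega> n) (T (\<eta> \<omega> n))) \<and>
      summable (\<lambda>n. (norm (\<xi> \<omega> n))\<^sup>2) \<and> summable (\<lambda>n. (norm (\<eta> \<omega> n))\<^sup>2)" ..
  have rep: "\<omega> = (\<lambda>T. \<Sum>n. cinner (\<xi> \<omega> n) (T (\<eta> \<omega> n)))" if "\<omega> \<in> \<Omega>" for \<omega>
    by (rule bspec[OF \<eta> that, THEN conjunct1])
  have summ: "summable (\<lambda>n. (norm (\<xi> \<omega> n))\<^sup>2)" "summable (\<lambda>n. (norm (\<eta> \<omega> n))\<^sup>2)" if "\<omega> \<in> \<Omega>" for \<omega>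
    using bspec[OF \<eta> that, THEN conjunct2] by (rule conjunct1, rule conjunct2)
  \<comment> \<open>The first \<open>n\<close> vectors of all sequences involved: term
    \<open>k\<close> of each functional becomes exact once \<open>n\<close> exceeds
    \<open>k\<close>.\<close>
  define A where "A n = (\<Union>\<omega>\<in>\<Omega>. \<xi> \<omega> ` {..<n} \<union> \<eta> \<omega> ` {..<n})" for n :: nat
  have "\<exists>U. finite U \<and> (\<forall>v\<in>U. \<forall>w\<in>U. cinner v w = (if v = w then 1 else 0)) \<and>
      (\<forall>a\<in>A n. approx_unit U a = a)" for n
  proof -
    \<comment> \<open>\<open>approx_unit_fixes\<close> needs the span of \<open>U\<close> to contain
      all translates of \<open>a\<close> by matrix units, not just \<open>a\<close>.\<close>
    have "finite (\<Union>a\<in>A n. (\<lambda>(j, i). u j i a) ` UNIV)"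
      using \<Omega>(1) by (auto simp: A_def)
    from finite_orthonormal_set[OF this] obtain U where U: "finite U"
      "\<And>v w. v \<in> U \<Longrightarrow> w \<in> U \<Longrightarrow> cinner v w = (if v = w then 1 else 0)"
      "\<And>b. b \<in> (\<Union>a\<in>A n. (\<lambda>(j, i). u j i a) ` UNIV) \<Longrightarrow> (\<Sum>w\<in>U. rank_one w w b) = b"
      by blast
    have "approx_unit U a = a" if "a \<in> A n" for a
      by (rule approx_unit_fixes, rule U(3)) (use that in force)
    with U(1,2) show ?thesis by blast
  qed
  then obtain U where U: "\<And>n. finite (U n)"
    "\<And>n v w. v \<in> U n \<Longrightarrow> w \<in> U n \<Longrightarrow> cinner v w = (if v = w then 1 else 0)"
    "\<And>n a. a \<in> A n \<Longrightarrow> approx_unit (U n) a = a"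
    by metis
  define X where "X n = approx_unit (U n) \<circ> T0 \<circ> approx_unit (U n)" for n
  obtain K where K: "\<And>x. norm (T0 x) \<le> norm x * K" "K \<ge> 0"
    using bounded_linear.nonneg_bounded[OF bounded_opsD(1)[OF T0]] by blast
  define C where "C = (real CARD('i))\<^sup>2"
  have C: "C \<ge> 0" by (simp add: C_def)
  have F: "norm (approx_unit (U n) v) \<le> C * norm v" for n v
    unfolding C_def by (rule approx_unit_norm[OF U(1,2)])
  have "X n \<in> V" for n
    unfolding X_def
    by (intro approx_unit_sandwich_mem sub T0 ampliation_sandwich_mem[OF V T0] ann)
  moreover have "(\<lambda>n. \<omega> (X n)) \<longlonglongrightarrow> \<omega> T0" if \<omega>: "\<omega> \<in> \<Omega>" for \<omega>
  proof -
    define a where "a k n = cinner (\<xi> \<omega> k) (X n (\<eta> \<omega> k))" for k n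
    define b where "b k = cinner (\<xi> \<omega> k) (T0 (\<eta> \<omega> k))" for k
    \<comment> \<open>A summable majorant independent of \<open>n\<close>: one factor
      \<open>C\<close> per approximate unit, \<open>K\<close> for \<open>T0\<close>. It permits
      exchanging limit and sum by Tannery's theorem.\<close>
    define M where "M k = C * K * C * ((norm (\<xi> \<omega> k))\<^sup>2 + (norm (\<eta> \<omega> k))\<^sup>2)" for k
    have a_eq: "a k n = cinner (approx_unit (U n) (\<xi> \<omega> k)) (T0 (approx_unit (U n) (\<eta> \<omega> k)))" for k n
      by (simp add: a_def X_def cinner_approx_unit)
    have lim: "(\<lambda>n. a k n) \<longlonglongrightarrow> b k" for k
    proof (rule tendsto_eventually)
      show "\<forall>\<^sub>F n in sequentially. a k n = b k"
        using eventually_gt_at_top[of k]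
      proof eventually_elim
        case (elim n)
        then have "\<xi> \<omega> k \<in> A n" "\<eta> \<omega> k \<in> A n" using \<omega> by (auto simp: A_def)
        then show ?case by (simp add: a_eq b_def U(3))
      qed
    qed
    have bound: "norm (a k n) \<le> M k" for k n
    proof -
      let ?x = "norm (\<xi> \<omega> k)" and ?y = "norm (\<eta> \<omega> k)"
      have "norm (T0 (approx_unit (U n) (\<eta> \<omega> k))) \<le> C * ?y * K"
        using K(1)[of "approx_unit (U n) (\<eta> \<omega> k)"] mult_right_mono[OF F[of n "\<eta> \<omega> k"] K(2)] by linarith
      then have "norm (a k n) \<le> (C * ?x) * (C * ?y * K)"
        unfolding a_eq using C K(2)
        by (intro order_trans[OF cinner_Cauchy_Schwarz] mult_mono F) auto
      also have "\<dots> = C * K * C * (?x * ?y)" by simp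
      also have "\<dots> \<le> M k"
        unfolding M_def
      proof (rule mult_left_mono)
        show "?x * ?y \<le> ?x\<^sup>2 + ?y\<^sup>2"
          using sum_squares_bound[of ?x ?y] zero_le_power2[of ?x] zero_le_power2[of ?y]
            mult_nonneg_nonneg[OF norm_ge_zero norm_ge_zero, of "\<xi> \<omega> k" "\<eta> \<omega> k"] by linarith
      qed (use C K(2) in simp)
      finally show ?thesis .
    qed
    have "summable M"
      unfolding M_def by (intro summable_mult summable_add summ \<omega>)
    then have "(\<lambda>n. suminf (\<lambda>k. a k n)) \<longlonglongrightarrow> suminf b"
      using tannerys_theorem[where M = M, OF lim] bound by (simp add: always_eventually)
    moreover have "\<omega> T = (\<Sum>k. cinner (\<xi> \<omega> k) (T (\<eta> \<omega> k)))" for T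
      by (rule fun_cong[OF rep[OF \<omega>]])
    ultimately show ?thesis
      by (simp only: a_def b_def[abs_def])
  qed
  ultimately show "\<exists>X::nat \<Rightarrow> _. (\<forall>n. X n \<in> V) \<and> (\<forall>\<omega>\<in>\<Omega>. (\<lambda>n. \<omega> (X n)) \<longlonglongrightarrow> \<omega> T0)"
    by blast
qed

lemma cinner_act: "cinner x (act Q T y) =
    (\<Sum>a\<in>UNIV. \<Sum>b\<in>UNIV. Q $ a $ b * cinner (u (fst b) (fst a) x) (T (u (snd b) (snd a) y)))"
  by (simp add: act_def cinner_sum_right cinner_scaleC_right u_adj)

text \<open>The set is an intersection of zero sets of matrix coefficients, and each of these is a
  finite combination of vector functionals.\<close>

lemma annihilated_closed: "closedin weak_star_topology {T \<in> bounded_ops. act Q T = (\<lambda>v. 0)}"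
proof -
  have eq: "{T \<in> bounded_ops. act Q T = (\<lambda>v. 0)} =
      (\<Inter>(x, y)\<in>UNIV. {T \<in> topspace weak_star_topology. cinner x (act Q T y) \<in> {0}})"
    by (auto simp: topspace_weak_star fun_eq_iff intro: cinner_ext_right)
  have "closedin weak_star_topology {T \<in> topspace weak_star_topology. cinner x (act Q T y) \<in> {0}}" for x y
  proof (rule closedin_continuous_map_preimage)
    show "continuous_map weak_star_topology euclidean (\<lambda>T. cinner x (act Q T y))"
    proof -
      have "continuous_map weak_star_topology euclidean
          (\<lambda>T. Q $ a $ b * cinner (u (fst b) (fst a) x) (T (u (snd b) (snd a) y)))" for a b
        using continuous_map_compose[OF continuous_map_normal_functional[OF vector_functional_normal],
            of euclidean "\<lambda>z. Q $ a $ b * z"]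
        by (simp add: o_def continuous_intros)
      then show ?thesis
        unfolding cinner_act by (intro continuous_map_sum) auto
    qed
  qed simp
  then show ?thesis
    unfolding eq by (intro closedin_INT) auto
qed

text \<open>Operators in the commutant pass through the matrix units, hence out of the action on
  either side.\<close>

lemma annihilated_bimodule: "op_bimodule u_commutant {T \<in> bounded_ops. act Q T = (\<lambda>v. 0)}"
  unfolding op_bimodule_def op_subspace_def
proof (intro conjI ballI allI)
  fix a b T assume ab: "a \<in> u_commutant" "b \<in> u_commutant" and T: "T \<in> {T \<in> bounded_ops. act Q T = (\<lambda>v. 0)}"
  have a: "a \<in> bounded_ops" and b: "b \<in> bounded_ops"
    and comm: "\<And>i j v. a (u i j v) = u i j (a v)" "\<And>i j v. b (u i j v) = u i j (b v)"
    using ab by (auto simp: u_commutant_def)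
  have "act Q (a \<circ> T \<circ> b) v = a (act Q T (b v))" for v
    by (simp add: act_def bounded_opsD(2,6)[OF a] comm)
  then show "a \<circ> T \<circ> b \<in> {T \<in> bounded_ops. act Q T = (\<lambda>v. 0)}"
    using T a b by (auto simp: bounded_opsD(4)[OF a] intro!: bounded_ops_o)
qed (auto simp: act_zero_right act_add_right act_scaleC_right fun_eq_iff
    intro: bounded_ops_zero bounded_ops_add bounded_ops_scaleC)

section \<open>The bimodule of a projection\<close>

definition projections :: "(complex^('i \<times> 'i)^('i \<times> 'i)) set" where
  "projections = {P \<in> tensor_algebra. P ** P = P \<and> mat_adj P = P}"

definition bimodule_of ::
  "complex^('i \<times> 'i)^('i \<times> 'i) \<Rightarrow> complex^('i \<times> 'i)^('i \<times> 'i) \<Rightarrow> ('h \<Rightarrow> 'h) set" where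
  "bimodule_of R P = (\<lambda>T. act R (act P T)) ` bounded_ops"

text \<open>\<open>T\<close> is in the range of \<open>R P\<close> iff \<open>R' T\<close> is in the
  range of the idempotent \<open>P\<close>, that is, iff \<open>1 - P\<close> kills
  \<open>R' T\<close>. Closedness and the bimodule property are read off this kernel.\<close>

lemma bimodule_of_eq:
  assumes R: "R \<in> tensor_algebra" "R' \<in> tensor_algebra" "R ** R' = mat 1" "R' ** R = mat 1"
    and P: "P \<in> tensor_algebra" "P ** P = P"
  shows "bimodule_of R P = {T \<in> bounded_ops. act ((mat 1 - P) ** R') T = (\<lambda>v. 0)}"
proof (intro set_eqI iffI)
  have D: "(mat 1 - P) ** R' \<in> tensor_algebra"
    by (intro block_algebra_mult block_algebra_diff block_algebra_one P R)
  fix T assume "T \<in> bimodule_of R P"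
  then obtain S where S: "S \<in> bounded_ops" "T = act R (act P S)" by (auto simp: bimodule_of_def)
  have "((mat 1 - P) ** R') ** (R ** P) = (mat 1 - P) ** P"
    by (metis R(4) matrix_mul_assoc matrix_mul_lid)
  also have "\<dots> = 0" by (simp add: mat_mult_diff_left P)
  finally have "act ((mat 1 - P) ** R') T = act 0 S"
    unfolding S(2) using S(1) D R P block_algebra_mult by (metis act_mult)
  then show "T \<in> {T \<in> bounded_ops. act ((mat 1 - P) ** R') T = (\<lambda>v. 0)}"
    using S by (simp add: act_zero_left act_bounded)
next
  fix T assume "T \<in> {T \<in> bounded_ops. act ((mat 1 - P) ** R') T = (\<lambda>v. 0)}"
  then have T: "T \<in> bounded_ops" "act ((mat 1 - P) ** R') T = (\<lambda>v. 0)" by auto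
  have "(mat 1 - P) ** R' = R' - P ** R'" by (simp add: mat_mult_diff_left)
  with T(2) have "act (P ** R') T = act R' T"
    by (auto simp: fun_eq_iff act_diff)
  then have "act P (act R' T) = act R' T"
    using act_mult[OF P(1) R(2) T(1)] by simp
  moreover have "act R (act R' T) = T"
    using act_mult[OF R(1,2) T(1)] by (simp add: R act_one T)
  ultimately have "T = act R (act P (act R' T))" by simp
  then show "T \<in> bimodule_of R P"
    unfolding bimodule_of_def using act_bounded[OF T(1)] by blast
qed

text \<open>\<open>(1 - P) R'\<close> kills the bimodule of \<open>P\<close>, hence all
  \<open>R Q T\<close>. As \<open>R' R = 1\<close>, the element \<open>(1 - P) Q\<close> acts as
  zero and so is zero.\<close>

lemma projection_le:
  assumes R: "R \<in> tensor_algebra" "R' \<in> tensor_algebra" "R ** R' = mat 1" "R' ** R = mat 1"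
    and P: "P \<in> tensor_algebra" "P ** P = P" and Q: "Q \<in> tensor_algebra"
    and sub: "bimodule_of R Q \<subseteq> bimodule_of R P"
  shows "P ** Q = Q"
proof -
  have "(mat 1 - P) ** Q = 0"
  proof (rule act_faithful)
    show "(mat 1 - P) ** Q \<in> tensor_algebra"
      by (intro block_algebra_mult block_algebra_diff block_algebra_one P Q)
    fix T :: "'h \<Rightarrow> 'h" assume T: "T \<in> bounded_ops"
    have "act R (act Q T) \<in> bimodule_of R P"
      using sub T by (auto simp: bimodule_of_def)
    then have "act ((mat 1 - P) ** R') (act R (act Q T)) = (\<lambda>v. 0)"
      using bimodule_of_eq[OF R P] by simp
    moreover have "((mat 1 - P) ** R') ** (R ** Q) = (mat 1 - P) ** Q"
      by (metis R(4) matrix_mul_assoc matrix_mul_lid)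
    moreover have "(mat 1 - P) ** R' \<in> tensor_algebra"
      by (intro block_algebra_mult block_algebra_diff block_algebra_one P R)
    ultimately show "act ((mat 1 - P) ** Q) T = (\<lambda>v. 0)"
      using T R Q block_algebra_mult by (metis act_mult)
  qed
  then show ?thesis by (simp add: mat_mult_diff_left)
qed

lemma bimodule_eq_bimodule_of:
  assumes R: "R \<in> tensor_algebra" "R' \<in> tensor_algebra" "R ** R' = mat 1" "R' ** R = mat 1"
    and V: "op_bimodule u_commutant V" "closedin weak_star_topology V"
  obtains P where "P \<in> projections" "V = bimodule_of R P"
proof -
  have VB: "V \<subseteq> bounded_ops" using V(1) by (auto simp: op_bimodule_def op_subspace_def)
  \<comment> \<open>The elements \<open>N R\<close> with \<open>N\<close> annihilating
    \<open>V\<close>; the shift by \<open>R\<close> anticipates the form \<open>(1 - P) R'\<close>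
    in \<open>bimodule_of_eq\<close>.\<close>
  define L where "L = {M \<in> tensor_algebra. \<forall>T\<in>V. act (M ** R') T = (\<lambda>v. 0)}"
  have "subspace L"
    unfolding subspace_def L_def
  proof (intro conjI ballI allI CollectI)
    fix c :: real and M T
    assume M: "M \<in> {M \<in> tensor_algebra. \<forall>T\<in>V. act (M ** R') T = (\<lambda>v. 0)}"
    show "c *\<^sub>R M \<in> tensor_algebra" using M by (auto simp: block_algebra_def)
    have "(c *\<^sub>R M) ** R' = c *\<^sub>R (M ** R')"
      by (simp add: matrix_matrix_mult_def vec_eq_iff scaleR_sum_right)
    then show "act ((c *\<^sub>R M) ** R') T = (\<lambda>v. 0)" if "T \<in> V"
      using M that by (simp add: fun_eq_iff act_scaleR)
  next
    fix M N T
    assume MN: "M \<in> {M \<in> tensor_algebra. \<forall>T\<in>V. act (M ** R') T = (\<lambda>v. 0)}"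
      "N \<in> {M \<in> tensor_algebra. \<forall>T\<in>V. act (M ** R') T = (\<lambda>v. 0)}"
    then show "M + N \<in> tensor_algebra" by (auto intro: block_algebra_add)
    show "act ((M + N) ** R') T = (\<lambda>v. 0)" if "T \<in> V"
      proof -
      have "(M + N) ** R' = M ** R' + N ** R'"
        by (simp add: matrix_matrix_mult_def vec_eq_iff distrib_right sum.distrib)
      then show ?thesis using MN that by (simp add: fun_eq_iff act_add)
    qed
  qed (auto simp: block_algebra_zero act_zero_left matrix_matrix_mult_def vec_eq_iff act_def)
  moreover have "L \<subseteq> tensor_algebra" by (auto simp: L_def)
  moreover have "a ** x \<in> L" if a: "a \<in> tensor_algebra" and x: "x \<in> L" for a x
  proof -
    have "act ((a ** x) ** R') T = (\<lambda>v. 0)" if "T \<in> V" for T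
    proof -
      have "act (a ** (x ** R')) T = act a (act (x ** R') T)"
        using a x R VB that by (intro act_mult block_algebra_mult) (auto simp: L_def)
      then show ?thesis
        using x that by (simp add: L_def matrix_mul_assoc act_zero_right)
    qed
    then show ?thesis using a x by (auto simp: L_def intro: block_algebra_mult)
  qed
  ultimately obtain p where p: "p \<in> L" "mat_adj p = p" "p ** p = p" "\<And>x. x \<in> L \<Longrightarrow> x ** p = x"
    using left_ideal_generated_by_projection[of L] by metis
  define P where "P = mat 1 - p"
  have pA: "p \<in> tensor_algebra" using p(1) by (simp add: L_def)
  have P: "P \<in> projections"
    using pA p(2,3)
    by (simp add: projections_def P_def block_algebra_diff block_algebra_one mat_adj_diff mat_adj_one
        mat_mult_diff_left mat_mult_diff_right)
  have "bimodule_of R P = {T \<in> bounded_ops. act (p ** R') T = (\<lambda>v. 0)}"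
    using bimodule_of_eq[OF R, of P] P by (simp add: projections_def) (simp add: P_def)
  also have "\<dots> = V"
  proof (intro equalityI subsetI)
    fix T assume "T \<in> V"
    then show "T \<in> {T \<in> bounded_ops. act (p ** R') T = (\<lambda>v. 0)}"
      using p(1) VB by (auto simp: L_def)
  next
    fix T0 assume "T0 \<in> {T \<in> bounded_ops. act (p ** R') T = (\<lambda>v. 0)}"
    then have T0: "T0 \<in> bounded_ops" "act (p ** R') T0 = (\<lambda>v. 0)" by auto
    show "T0 \<in> V"
    proof (rule bimodule_annihilator[OF V T0(1)])
      fix Q assume Q: "Q \<in> tensor_algebra" "\<And>T. T \<in> V \<Longrightarrow> act Q T = (\<lambda>v. 0)"
      \<comment> \<open>\<open>Q R\<close> lies in \<open>L\<close>, so \<open>Q R = Q R p\<close>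
        and \<open>Q = (Q R) (p R')\<close>: whatever \<open>p R'\<close> kills is killed by
        \<open>Q\<close>.\<close>
      have QR: "Q ** R \<in> tensor_algebra" using Q(1) R(1) by (rule block_algebra_mult)
      have "(Q ** R) ** R' = Q" by (metis R(3) matrix_mul_assoc matrix_mul_rid)
      then have "Q ** R \<in> L" using Q QR by (simp add: L_def)
      then have "Q = (Q ** R) ** (p ** R')"
        by (metis \<open>(Q ** R) ** R' = Q\<close> matrix_mul_assoc p(4))
      then have "act Q T0 = act (Q ** R) (act (p ** R') T0)"
        by (metis QR act_mult T0(1) block_algebra_mult pA R(2))
      then show "act Q T0 = (\<lambda>v. 0)" by (simp add: T0(2) act_zero_right)
    qed
  qed
  finally show ?thesis using that P by blast
qed

lemma bij_betw_bimodule_of: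
  assumes R: "R \<in> tensor_algebra" "R' \<in> tensor_algebra" "R ** R' = mat 1" "R' ** R = mat 1"
  shows "bij_betw (bimodule_of R) projections
    {V. op_bimodule u_commutant V \<and> closedin weak_star_topology V}"
proof (rule bij_betw_imageI)
  show "inj_on (bimodule_of R) projections"
  proof (rule inj_onI)
    fix P Q assume P: "P \<in> projections" and Q: "Q \<in> projections" and eq: "bimodule_of R P = bimodule_of R Q"
    have "P ** Q = Q" "Q ** P = P"
      using projection_le[OF R, of P Q] projection_le[OF R, of Q P] P Q eq by (auto simp: projections_def)
    \<comment> \<open>The adjoint of \<open>Q P = P\<close> is \<open>P Q = P\<close>, to be
      compared with \<open>P Q = Q\<close>.\<close>
    then have "mat_adj (Q ** P) = mat_adj P" "mat_adj P = P" "mat_adj Q = Q"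
      using P Q by (auto simp: projections_def)
    then have "P ** Q = P" by (simp add: mat_adj_mult)
    with \<open>P ** Q = Q\<close> show "P = Q" by simp
  qed
  show "bimodule_of R ` projections = {V. op_bimodule u_commutant V \<and> closedin weak_star_topology V}"
  proof (intro equalityI subsetI)
    fix V assume "V \<in> bimodule_of R ` projections"
    then obtain P where P: "P \<in> tensor_algebra" "P ** P = P" "V = bimodule_of R P"
      by (auto simp: projections_def)
    show "V \<in> {V. op_bimodule u_commutant V \<and> closedin weak_star_topology V}"
      unfolding P(3) bimodule_of_eq[OF R P(1,2)] using annihilated_closed annihilated_bimodule by blast
  qed (use bimodule_eq_bimodule_of[OF R] in blast)
qed

text \<open>By the assumption on \<open>R\<close>, the transformation in \<open>op_adj_act\<close>
  fixes it. Self-adjointness of \<open>P\<close> turns conjugation into transposition, leaving the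
  matrix of the flip.\<close>

lemma op_adj_bimodule_of:
  assumes R: "\<And>a b. cnj (R $ prod.swap a $ prod.swap b) = R $ a $ b" and P: "mat_adj P = P"
  shows "op_adj ` bimodule_of R P = bimodule_of R (\<chi> a b. P $ prod.swap b $ prod.swap a)"
proof -
  have "cnj (P $ prod.swap a $ prod.swap b) = P $ prod.swap b $ prod.swap a" for a b
    using arg_cong[OF P, of "\<lambda>M. M $ prod.swap b $ prod.swap a"] by (simp add: mat_adj_def)
  then have adj: "op_adj (act R (act P T)) = act R (act (\<chi> a b. P $ prod.swap b $ prod.swap a) (op_adj T))"
    if "T \<in> bounded_ops" for T
    using that by (simp add: op_adj_act act_bounded R)
  have img: "op_adj ` bounded_ops = (bounded_ops :: ('h \<Rightarrow> 'h) set)"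
  proof (intro equalityI subsetI)
    fix T :: "'h \<Rightarrow> 'h" assume "T \<in> bounded_ops"
    then show "T \<in> op_adj ` bounded_ops"
      by (intro image_eqI[of T op_adj "op_adj T"]) (simp_all add: op_adj_op_adj op_adj_bounded)
  qed (auto intro: op_adj_bounded)
  have "op_adj ` bimodule_of R P =
      (\<lambda>T. act R (act (\<chi> a b. P $ prod.swap b $ prod.swap a) T)) ` (op_adj ` bounded_ops)"
    unfolding bimodule_of_def image_image by (rule image_cong) (simp_all add: adj)
  then show ?thesis
    by (simp add: img bimodule_of_def)
qed

end

section \<open>Representations of block algebras\<close>

lemma matrix_unit_mult:
  "matrix_unit i j ** matrix_unit k l = (if j = k then matrix_unit i l else (0 :: complex^'i::finite^'i))"
proof -
  have "(\<Sum>m\<in>UNIV. (if p = i \<and> m = j then 1 else 0) * (if m = k \<and> q = l then 1 else 0)) =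
      (if j = k \<and> p = i \<and> q = l then 1 else (0 :: complex))" for p q
  proof -
    have "(\<Sum>m\<in>UNIV. (if p = i \<and> m = j then 1 else 0) * (if m = k \<and> q = l then 1 else 0)) =
        (\<Sum>m\<in>UNIV. if m = j then (if j = k \<and> p = i \<and> q = l then 1 else (0 :: complex)) else 0)"
      by (intro sum.cong) auto
    then show ?thesis by simp
  qed
  then show ?thesis
    by (simp add: matrix_matrix_mult_def matrix_unit_def vec_eq_iff)
qed

lemma matrix_unit_in_block_algebra: "blk i = blk j \<Longrightarrow> matrix_unit i j \<in> block_algebra blk"
  by (auto simp: matrix_unit_def block_algebra_def)

lemma mat_adj_matrix_unit: "mat_adj (matrix_unit i j) = matrix_unit j i"
  by (auto simp: mat_adj_def matrix_unit_def vec_eq_iff)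

lemma matrix_unit_expansion:
  fixes x :: "complex^'i::finite^'i"
  shows "x = (\<Sum>a\<in>UNIV. mat_scale (x $ fst a $ snd a) (matrix_unit (fst a) (snd a)))"
proof -
  have "(\<Sum>a\<in>UNIV. mat_scale (x $ fst a $ snd a) (matrix_unit (fst a) (snd a))) $ p $ q = x $ p $ q" for p q
  proof -
    have "(\<Sum>a\<in>UNIV. mat_scale (x $ fst a $ snd a) (matrix_unit (fst a) (snd a))) $ p $ q =
        (\<Sum>a\<in>UNIV. if a = (p, q) then x $ p $ q else 0)"
      unfolding sum_component by (intro sum.cong) (auto simp: mat_scale_def matrix_unit_def prod_eq_iff)
    then show ?thesis by simp
  qed
  then show ?thesis by (simp add: vec_eq_iff)
qed

locale block_rep =
  fixes blk :: "'i::finite \<Rightarrow> 'a" and \<pi> :: "complex^'i^'i \<Rightarrow> ('h::complex_hilbert_space \<Rightarrow> 'h)"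
  assumes rep: "unital_faithful_rep blk \<pi>"
begin

lemma rep_bounded: "x \<in> block_algebra blk \<Longrightarrow> \<pi> x \<in> bounded_ops"
  and rep_add: "x \<in> block_algebra blk \<Longrightarrow> y \<in> block_algebra blk \<Longrightarrow> \<pi> (x + y) v = \<pi> x v + \<pi> y v"
  and rep_scale: "x \<in> block_algebra blk \<Longrightarrow> \<pi> (mat_scale c x) v = c *\<^sub>C \<pi> x v"
  and rep_mult: "x \<in> block_algebra blk \<Longrightarrow> y \<in> block_algebra blk \<Longrightarrow> \<pi> (x ** y) v = \<pi> x (\<pi> y v)"
  and rep_adj: "x \<in> block_algebra blk \<Longrightarrow> \<pi> (mat_adj x) = op_adj (\<pi> x)"
  and rep_one: "\<pi> (mat 1) v = v"
  and rep_inj: "inj_on \<pi> (block_algebra blk)"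
  using rep by (auto simp: unital_faithful_rep_def)

lemma rep_zero: "\<pi> 0 v = 0"
  using rep_scale[OF block_algebra_zero, of 0 v] by (simp add: mat_scale_def zero_vec_def)

lemma rep_sum:
  assumes "\<And>a. a \<in> I \<Longrightarrow> f a \<in> block_algebra blk"
  shows "\<pi> (\<Sum>a\<in>I. f a) v = (\<Sum>a\<in>I. \<pi> (f a) v)"
proof -
  have "\<pi> (\<Sum>a\<in>I. f a) v = (\<Sum>a\<in>I. \<pi> (f a) v) \<and> (\<Sum>a\<in>I. f a) \<in> block_algebra blk"
    using assms
    by (induction I rule: infinite_finite_induct)
      (auto simp: rep_zero rep_add block_algebra_zero intro: block_algebra_add)
  then show ?thesis ..
qed

text \<open>\<open>\<pi>\<close> is constrained on the block algebra only, so its value at a matrix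
  unit joining two blocks is replaced by 0.\<close>

definition unit_op :: "'i \<Rightarrow> 'i \<Rightarrow> 'h \<Rightarrow> 'h" where
  "unit_op i j = (if blk i = blk j then \<pi> (matrix_unit i j) else (\<lambda>v. 0))"

lemma rep_expansion:
  assumes x: "x \<in> block_algebra blk"
  shows "\<pi> x v = (\<Sum>i\<in>UNIV. \<Sum>j\<in>UNIV. x $ i $ j *\<^sub>C unit_op i j v)"
proof -
  let ?f = "\<lambda>a. mat_scale (x $ fst a $ snd a) (matrix_unit (fst a) (snd a))"
  have off: "x $ fst a $ snd a = 0" if "blk (fst a) \<noteq> blk (snd a)" for a
    using x that by (simp add: block_algebra_def)
  have f: "?f a \<in> block_algebra blk" for a
    using off[of a] by (auto simp: block_algebra_def mat_scale_def matrix_unit_def)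
  have "\<pi> (?f a) v = x $ fst a $ snd a *\<^sub>C unit_op (fst a) (snd a) v" for a
  proof (cases "blk (fst a) = blk (snd a)")
    case True
    then show ?thesis
      by (simp add: rep_scale matrix_unit_in_block_algebra unit_op_def)
  next
    case False
    then have "?f a = 0" using off[of a] by (simp add: mat_scale_def vec_eq_iff)
    then show ?thesis using False by (simp add: rep_zero unit_op_def)
  qed
  then have "\<pi> x v = (\<Sum>a\<in>UNIV. x $ fst a $ snd a *\<^sub>C unit_op (fst a) (snd a) v)"
    using rep_sum[of UNIV ?f v] f by (simp flip: matrix_unit_expansion)
  then show ?thesis
    by (simp add: sum.cartesian_product split_def flip: UNIV_Times_UNIV)
qed

sublocale matrix_units blk unit_op
proof
  show bounded: "unit_op i j \<in> bounded_ops" for i j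
    by (simp add: unit_op_def bounded_ops_zero rep_bounded matrix_unit_in_block_algebra)
  show off: "blk i \<noteq> blk j \<Longrightarrow> unit_op i j v = 0" for i j v
    by (simp add: unit_op_def)
  show "unit_op i j (unit_op k l v) = (if j = k \<and> blk i = blk j then unit_op i l v else 0)" for i j k l v
  proof (cases "blk i = blk j \<and> blk k = blk l")
    case True
    then have "unit_op i j (unit_op k l v) = \<pi> (matrix_unit i j ** matrix_unit k l) v"
      by (simp add: unit_op_def rep_mult matrix_unit_in_block_algebra)
    then show ?thesis
      using True by (simp add: matrix_unit_mult rep_zero unit_op_def)
  next
    case False
    then show ?thesis
      using off bounded_opsD(4)[OF bounded[of i j]] by (metis)
  qed
  show "cinner (unit_op i j x) y = cinner x (unit_op j i y)" for i j x y
  proof (cases "blk i = blk j")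
    case True
    then have m: "matrix_unit j i \<in> block_algebra blk" "blk j = blk i"
      by (simp_all add: matrix_unit_in_block_algebra)
    then have "\<pi> (matrix_unit i j) = op_adj (\<pi> (matrix_unit j i))"
      using rep_adj[OF m(1)] by (simp add: mat_adj_matrix_unit)
    then show ?thesis
      using True m by (simp add: unit_op_def cinner_op_adj_left rep_bounded)
  qed (simp add: unit_op_def)
  show "(\<Sum>i\<in>UNIV. unit_op i i v) = v" for v
  proof -
    have "v = (\<Sum>i\<in>UNIV. \<Sum>j\<in>UNIV. mat 1 $ i $ j *\<^sub>C unit_op i j v)"
      using rep_expansion[OF block_algebra_one, of v] by (simp add: rep_one)
    also have "\<dots> = (\<Sum>i\<in>UNIV. \<Sum>j\<in>UNIV. if j = i then unit_op i j v else 0)"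
      by (intro sum.cong) (auto simp: mat_def)
    also have "\<dots> = (\<Sum>i\<in>UNIV. unit_op i i v)"
      by simp
    finally show ?thesis by simp
  qed
  \<comment> \<open>Here injectivity of the representation is used: a diagonal unit acting as zero
    would itself be zero.\<close>
  show "\<exists>v. unit_op i i v \<noteq> 0" for i
  proof (rule ccontr)
    assume "\<nexists>v. unit_op i i v \<noteq> 0"
    then have "\<pi> (matrix_unit i i) = \<pi> 0"
      by (simp add: unit_op_def fun_eq_iff rep_zero)
    then have "matrix_unit i i = (0 :: complex^'i^'i)"
      by (intro inj_onD[OF rep_inj]) (simp_all add: matrix_unit_in_block_algebra block_algebra_zero)
    then have "matrix_unit i i $ i $ i = (0 :: complex)" by simp
    then show False by (simp add: matrix_unit_def)
  qed
qed

lemma commutant_eq: "commutant (\<pi> ` block_algebra blk) = u_commutant"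
proof (intro equalityI subsetI)
  fix T assume T: "T \<in> commutant (\<pi> ` block_algebra blk)"
  then have TB: "T \<in> bounded_ops" and comm: "\<And>x v. x \<in> block_algebra blk \<Longrightarrow> T (\<pi> x v) = \<pi> x (T v)"
    by (auto simp: commutant_def fun_eq_iff)
  have "T (unit_op i j v) = unit_op i j (T v)" for i j v
    by (simp add: unit_op_def comm matrix_unit_in_block_algebra bounded_opsD(4)[OF TB])
  with TB show "T \<in> u_commutant" by (simp add: u_commutant_def)
next
  fix T assume T: "T \<in> u_commutant"
  then have TB: "T \<in> bounded_ops" and comm: "\<And>i j v. T (unit_op i j v) = unit_op i j (T v)"
    by (auto simp: u_commutant_def)
  have "T (\<pi> x v) = \<pi> x (T v)" if "x \<in> block_algebra blk" for x v
    by (simp add: rep_expansion[OF that] bounded_opsD(2,6)[OF TB] comm)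
  with TB show "T \<in> commutant (\<pi> ` block_algebra blk)"
    by (auto simp: commutant_def fun_eq_iff)
qed

end

text \<open>Tensors are matrices with rows indexed by the outer and columns by the inner indices of
  \<open>e\<^sub>i\<^sub>j \<otimes> e\<^sub>k\<^sub>l\<close>; this turns the multiplication of \<open>B \<otimes> B\<^sup>o\<^sup>p\<close> into the matrix product.\<close>

definition tensor_mat :: "'i::finite tensor \<Rightarrow> complex^('i \<times> 'i)^('i \<times> 'i)" where
  "tensor_mat t = (\<chi> a b. t (fst a) (fst b) (snd b) (snd a))"

lemma tensor_mat_inj: "tensor_mat s = tensor_mat t \<longleftrightarrow> s = t"
  by (auto simp: tensor_mat_def vec_eq_iff fun_eq_iff)

lemma tensor_mat_mult: "tensor_mat (op_mult s t) = tensor_mat s ** tensor_mat t"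
  by (simp add: tensor_mat_def op_mult_def matrix_matrix_mult_def vec_eq_iff
      sum.cartesian_product split_def flip: UNIV_Times_UNIV)

lemma tensor_mat_adj: "tensor_mat (tensor_adj t) = mat_adj (tensor_mat t)"
  by (simp add: tensor_mat_def tensor_adj_def mat_adj_def vec_eq_iff)

lemma tensor_mat_flip:
  "tensor_mat (tensor_flip t) = (\<chi> a b. tensor_mat t $ prod.swap b $ prod.swap a)"
  by (simp add: tensor_mat_def tensor_flip_def vec_eq_iff)

lemma tensor_mat_space:
  "tensor_mat t \<in> block_algebra (map_prod blk blk) \<longleftrightarrow> t \<in> tensor_space blk"
  by (auto simp: tensor_mat_def tensor_space_def block_algebra_def)

lemma tensor_mat_surj: "\<exists>t. tensor_mat t = M"
  by (rule exI[of _ "\<lambda>i j k l. M $ (i, l) $ (j, k)"]) (simp add: tensor_mat_def vec_eq_iff)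

lemma tensor_mat_one: "tensor_mat (elem_tensor (mat 1) (mat 1)) = mat 1"
  by (auto simp: tensor_mat_def elem_tensor_def mat_def vec_eq_iff)

section \<open>Tensors acting through the representation\<close>

context block_rep
begin

lemma bij_betw_tensor_mat: "bij_betw tensor_mat (op_projections blk) projections"
proof (rule bij_betw_imageI)
  show "inj_on tensor_mat (op_projections blk)"
    by (rule inj_onI) (simp add: tensor_mat_inj)
  have iff: "tensor_mat t \<in> projections \<longleftrightarrow> t \<in> op_projections blk" for t
    by (simp add: projections_def op_projections_def tensor_mat_space tensor_mat_inj
        flip: tensor_mat_mult tensor_mat_adj)
  show "tensor_mat ` op_projections blk = projections"
  proof (intro equalityI subsetI)
    fix M assume M: "M \<in> projections"
    obtain t where "tensor_mat t = M" using tensor_mat_surj by blast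
    with M iff[of t] show "M \<in> tensor_mat ` op_projections blk" by blast
  qed (use iff in blast)
qed

lemma act_elem_tensor:
  assumes b: "b \<in> block_algebra blk" and c: "c \<in> block_algebra blk" and T: "T \<in> bounded_ops"
  shows "act (tensor_mat (elem_tensor b c)) T v = \<pi> b (T (\<pi> c v))"
proof -
  have "\<pi> b (T (\<pi> c v)) = (\<Sum>i\<in>UNIV. \<Sum>j\<in>UNIV. \<Sum>k\<in>UNIV. \<Sum>l\<in>UNIV.
      (b $ i $ j * c $ k $ l) *\<^sub>C unit_op i j (T (unit_op k l v)))"
    by (simp add: rep_expansion b c bounded_opsD(2,6)[OF T] u_simps scaleC_sum_right scaleC_scaleC)
  also have "\<dots> = (\<Sum>i\<in>UNIV. \<Sum>j\<in>UNIV. \<Sum>l\<in>UNIV. \<Sum>k\<in>UNIV.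
      (b $ i $ j * c $ k $ l) *\<^sub>C unit_op i j (T (unit_op k l v)))"
    by (rule sum.cong[OF refl], rule sum.cong[OF refl], rule sum.swap)
  also have "\<dots> = (\<Sum>i\<in>UNIV. \<Sum>l\<in>UNIV. \<Sum>j\<in>UNIV. \<Sum>k\<in>UNIV.
      (b $ i $ j * c $ k $ l) *\<^sub>C unit_op i j (T (unit_op k l v)))"
    by (rule sum.cong[OF refl], rule sum.swap)
  also have "\<dots> = act (tensor_mat (elem_tensor b c)) T v"
    by (simp add: act_def tensor_mat_def elem_tensor_def sum_UNIV_prod)
  finally show ?thesis by simp
qed

text \<open>Connects \<open>act\<close> with the formula in \<open>Phi\<close>: \<open>\<pi>\<close>
  of a matrix unit may differ from \<open>unit_op\<close> only across blocks, where the coefficients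
  of \<open>t\<close> vanish.\<close>

lemma act_tensor_mat:
  assumes t: "t \<in> tensor_space blk" and T: "T \<in> bounded_ops"
  shows "act (tensor_mat t) T v = (\<Sum>i\<in>UNIV. \<Sum>j\<in>UNIV. \<Sum>k\<in>UNIV. \<Sum>l\<in>UNIV.
      t i j k l *\<^sub>C \<pi> (matrix_unit i j) (T (\<pi> (matrix_unit k l) v)))"
proof -
  have eq: "t i j k l *\<^sub>C \<pi> (matrix_unit i j) (T (\<pi> (matrix_unit k l) v)) =
      t i j k l *\<^sub>C unit_op i j (T (unit_op k l v))" for i j k l
  proof (cases "blk i = blk j \<and> blk k = blk l")
    case False
    then have "t i j k l = 0" using t by (auto simp: tensor_space_def)
    then show ?thesis by simp
  qed (simp add: unit_op_def)
  have "(\<Sum>i\<in>UNIV. \<Sum>j\<in>UNIV. \<Sum>k\<in>UNIV. \<Sum>l\<in>UNIV. t i j k l *\<^sub>C unit_op i j (T (unit_op k l v))) =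
      (\<Sum>i\<in>UNIV. \<Sum>j\<in>UNIV. \<Sum>l\<in>UNIV. \<Sum>k\<in>UNIV. t i j k l *\<^sub>C unit_op i j (T (unit_op k l v)))"
    by (rule sum.cong[OF refl], rule sum.cong[OF refl], rule sum.swap)
  also have "\<dots> = (\<Sum>i\<in>UNIV. \<Sum>l\<in>UNIV. \<Sum>j\<in>UNIV. \<Sum>k\<in>UNIV. t i j k l *\<^sub>C unit_op i j (T (unit_op k l v)))"
    by (rule sum.cong[OF refl], rule sum.swap)
  also have "\<dots> = act (tensor_mat t) T v"
    by (simp add: act_def tensor_mat_def sum_UNIV_prod)
  finally show ?thesis unfolding eq by simp
qed

end

text \<open>Substituting \<open>T \<rho>\<^sup>1\<^sup>/\<^sup>2\<close> for the argument of \<open>\<Phi>(P)\<close> makes \<open>V\<^sub>P\<close> the range of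
  \<open>(\<rho>\<^sup>1\<^sup>/\<^sup>4 \<otimes> \<rho>\<^sup>1\<^sup>/\<^sup>4) P\<close>, in which the two tensor legs enter symmetrically.\<close>

locale block_rep_density = block_rep blk \<pi>
  for blk :: "'i::finite \<Rightarrow> 'a" and \<pi> :: "complex^'i^'i \<Rightarrow> ('h::complex_hilbert_space \<Rightarrow> 'h)" +
  fixes \<rho> :: "complex^'i^'i"
  assumes rho: "\<rho> \<in> block_algebra blk" "pos_def \<rho>"
begin

text \<open>The element \<open>R\<close> of the outline is \<open>twist (1/4)\<close>, with inverse
  \<open>twist (- 1/4)\<close>.\<close>

definition twist :: "complex \<Rightarrow> complex^('i \<times> 'i)^('i \<times> 'i)" where
  "twist z = tensor_mat (elem_tensor (mat_powr \<rho> z) (mat_powr \<rho> z))"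

lemma rho_powr: "mat_powr \<rho> z \<in> block_algebra blk"
  using rho by (intro mat_powr_in_block_algebra) (auto simp: pos_def_def)

lemma rep_powr: "\<pi> (mat_powr \<rho> a) (\<pi> (mat_powr \<rho> b) v) = \<pi> (mat_powr \<rho> (a + b)) v"
  by (simp add: rep_mult[symmetric] rho_powr mat_powr_add[OF rho(2)])

lemma twist_mem: "twist z \<in> tensor_algebra"
  unfolding twist_def tensor_mat_space by (intro elem_tensor_in_space rho_powr)

lemma twist_mult: "twist a ** twist b = twist (a + b)"
  by (simp add: twist_def op_mult_elem mat_powr_add[OF rho(2)] add.commute[of b] flip: tensor_mat_mult)

lemma twist_0: "twist 0 = mat 1"
  by (simp add: twist_def mat_powr_0[OF rho(2)] tensor_mat_one)

text \<open>Real powers of \<open>\<rho>\<close> are self-adjoint and both legs agree, so adjoint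
  and flip leave the tensor unchanged.\<close>

lemma twist_swap: "cnj (twist (complex_of_real r) $ prod.swap a $ prod.swap b) = twist (complex_of_real r) $ a $ b"
proof -
  have "cnj (mat_powr \<rho> (complex_of_real r) $ i $ j) = mat_powr \<rho> (complex_of_real r) $ j $ i" for i j
    using arg_cong[OF mat_adj_mat_powr[OF rho(2), of r], of "\<lambda>x. x $ j $ i"] by (simp add: mat_adj_def)
  then show ?thesis
    by (simp add: twist_def tensor_mat_def elem_tensor_def mult.commute)
qed

lemma V_of_eq:
  assumes P: "P \<in> tensor_space blk"
  shows "V_of \<pi> \<rho> P = bimodule_of (twist (1/4)) (tensor_mat P)"
proof -
  let ?q = "\<lambda>z. \<pi> (mat_powr \<rho> z)"
  have q: "?q z \<in> bounded_ops" for z by (intro rep_bounded rho_powr)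
  have key: "modular \<pi> \<rho> (\<i> / 4) (Phi \<pi> \<rho> P x) = act (twist (1/4)) (act (tensor_mat P) (x \<circ> ?q (- 1/2)))"
    if x: "x \<in> bounded_ops" for x
  proof
    fix v
    have xq: "x \<circ> ?q (- 1/2) \<in> bounded_ops" by (intro bounded_ops_o x q)
    \<comment> \<open>The factor \<open>\<rho>\<close> to the power \<open>-1/2\<close> from the
      modular group is absorbed into \<open>x\<close>, leaving \<open>1/2\<close> on the right; the
      outer twist by \<open>-1/4\<close> reduces this to \<open>1/4\<close>, matching the
      left.\<close>
    have "Phi \<pi> \<rho> P x w = act (tensor_mat P) (x \<circ> ?q (- 1/2)) (?q (1/2) w)" for w
      unfolding Phi_def act_tensor_mat[OF P xq] by (simp add: modular_def)
    then have "modular \<pi> \<rho> (\<i> / 4) (Phi \<pi> \<rho> P x) v =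
        ?q (1/4) (act (tensor_mat P) (x \<circ> ?q (- 1/2)) (?q (1/4) v))"
      by (simp add: modular_def rep_powr)
    also have "\<dots> = act (twist (1/4)) (act (tensor_mat P) (x \<circ> ?q (- 1/2))) v"
      unfolding twist_def by (rule act_elem_tensor[OF rho_powr rho_powr act_bounded[OF xq], symmetric])
    finally show "modular \<pi> \<rho> (\<i> / 4) (Phi \<pi> \<rho> P x) v = act (twist (1/4)) (act (tensor_mat P) (x \<circ> ?q (- 1/2))) v" .
  qed
  \<comment> \<open>Right multiplication by an invertible operator maps \<open>bounded_ops\<close>
    onto itself, so absorbing that factor does not change the range.\<close>
  have img: "(\<lambda>x. x \<circ> ?q (- 1/2)) ` bounded_ops = bounded_ops"
  proof (intro equalityI subsetI)
    fix y :: "'h \<Rightarrow> 'h" assume y: "y \<in> bounded_ops"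
    have "y = (y \<circ> ?q (1/2)) \<circ> ?q (- 1/2)"
      by (simp add: fun_eq_iff rep_powr mat_powr_0[OF rho(2)] rep_one)
    then show "y \<in> (\<lambda>x. x \<circ> ?q (- 1/2)) ` bounded_ops"
      using bounded_ops_o[OF y q] by blast
  qed (auto intro: bounded_ops_o q)
  have "V_of \<pi> \<rho> P = (\<lambda>T. act (twist (1/4)) (act (tensor_mat P) T)) ` ((\<lambda>x. x \<circ> ?q (- 1/2)) ` bounded_ops)"
    unfolding V_of_def image_image by (rule image_cong) (simp_all add: key)
  then show ?thesis by (simp only: img bimodule_of_def)
qed

lemma bij_betw_V_of:
  "bij_betw (V_of \<pi> \<rho>) (op_projections blk) {V. op_bimodule u_commutant V \<and> closedin weak_star_topology V}"
proof -
  have "bij_betw (bimodule_of (twist (1/4))) projections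
      {V. op_bimodule u_commutant V \<and> closedin weak_star_topology V}"
    by (rule bij_betw_bimodule_of[of _ "twist (- 1/4)"]) (simp_all add: twist_mem twist_mult twist_0)
  then have "bij_betw (bimodule_of (twist (1/4)) \<circ> tensor_mat) (op_projections blk)
      {V. op_bimodule u_commutant V \<and> closedin weak_star_topology V}"
    by (rule bij_betw_trans[OF bij_betw_tensor_mat])
  then show ?thesis
    by (rule bij_betw_cong[THEN iffD1, rotated]) (simp add: V_of_eq op_projections_def)
qed

lemma V_of_flip:
  assumes P: "P \<in> op_projections blk"
  shows "V_of \<pi> \<rho> (tensor_flip P) = op_adj ` V_of \<pi> \<rho> P"
proof -
  have "P \<in> tensor_space blk" "tensor_flip P \<in> tensor_space blk" "mat_adj (tensor_mat P) = tensor_mat P"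
    using P by (auto simp: op_projections_def tensor_space_def tensor_flip_def simp flip: tensor_mat_adj)
  then show ?thesis
    using op_adj_bimodule_of[of "twist (1/4)" "tensor_mat P"] twist_swap[of "1/4"]
    by (simp add: V_of_eq tensor_mat_flip)
qed

end

theorem theorem2:
  fixes blk :: "'i::finite \<Rightarrow> 'a"
    and \<pi> :: "complex^'i^'i \<Rightarrow> ('h::complex_hilbert_space \<Rightarrow> 'h)"
    and \<psi> :: "complex^'i^'i \<Rightarrow> complex"
    and \<rho> :: "complex^'i^'i"
  assumes "unital_faithful_rep blk \<pi>"
    and "faithful_positive_functional blk \<psi>"
    and "mult_coisometric blk \<psi>"
    and "is_density blk \<psi> \<rho>"
  shows "bij_betw (V_of \<pi> \<rho>) (op_projections blk)
           {V. op_bimodule (commutant (\<pi> ` block_algebra blk)) V \<and> closedin weak_star_topology V}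
         \<and> (\<forall>P\<in>op_projections blk. V_of \<pi> \<rho> (tensor_flip P) = op_adj ` V_of \<pi> \<rho> P)"
proof -
  interpret block_rep_density blk \<pi> \<rho>
    using assms(1,4) by unfold_locales (auto simp: is_density_def)
  show ?thesis
    using bij_betw_V_of V_of_flip by (simp add: commutant_eq)
qed

end
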